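(* Let $X$ be an infinite compact space which is simple and cleavable over an ordinal. Then $X$ is homeomorphic to an ordinal.
   Context: A space $X$ is cleavable over a space $Y$ if for every $A\subseteq X$ there is a continuous $f:X\to Y$ with $f(A)\cap f(X\setminus A)=\emptyset$. Ordinals carry the order topology. Derived sets: $X^0=X$, $X^{\alpha+1}=(X^\alpha)'$, $X^\lambda=\bigcap_{\alpha<\lambda}X^\alpha$ for limit $\lambda$. For a compact scattered space the Cantor–Bendixson rank $\mathrm{CB}(X)$ (least $\mu$ with $X^\mu=\emptyset$) is a successor $\beta+1$ and $X^\beta$ is finite; $X$ is called simple (with $\hat x$) if $X^\beta=\{\hat x\}$ is a single point. *)

theory Defs
  imports "HOL-Analysis.Analysis"
begin

text \<open>Order topology on the field of a (linear) order relation r: generated by the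
  open rays (-infty,a) and (a,+infty), together with the whole field (so that a
  one-point order gets its nonempty topspace).  For a well-order r this is the
  ordinal (order type of r) with its order topology.\<close>
definition ord_topology :: "'b rel \<Rightarrow> 'b topology" where
  "ord_topology r = topology_generated_by
     ({Field r} \<union> {{y. (y, a) \<in> r \<and> y \<noteq> a} | a. a \<in> Field r}
                \<union> {{y. (a, y) \<in> r \<and> y \<noteq> a} | a. a \<in> Field r})"

definition cleavable_over :: "'a topology \<Rightarrow> 'b topology \<Rightarrow> bool" where
  "cleavable_over X Y \<longleftrightarrow>
     (\<forall>A. A \<subseteq> topspace X \<longrightarrow>
        (\<exists>f. continuous_map X Y f \<and> f ` A \<inter> f ` (topspace X - A) = {}))"

text \<open>The family of all transfinite derived sets X^alpha: it contains X^0 = X,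
  is closed under X^(alpha+1) = (X^alpha)' and under intersections of nonempty
  subfamilies (limit stages), and is the least such family.\<close>
inductive_set cb_derived_sets :: "'a topology \<Rightarrow> 'a set set" for X where
  top: "topspace X \<in> cb_derived_sets X"
| succ: "S \<in> cb_derived_sets X \<Longrightarrow> X derived_set_of S \<in> cb_derived_sets X"
| lim: "(\<And>S. S \<in> F \<Longrightarrow> S \<in> cb_derived_sets X) \<Longrightarrow> F \<noteq> {} \<Longrightarrow> \<Inter>F \<in> cb_derived_sets X"

text \<open>X is simple: for some beta, X^beta = {x} and X^(beta+1) = {}, i.e. CB(X) = beta+1
  and the top-level derived set X^beta is a single point.\<close>
definition cb_simple :: "'a topology \<Rightarrow> bool" where
  "cb_simple X \<longleftrightarrow>
     (\<exists>x. {x} \<in> cb_derived_sets X \<and> X derived_set_of {x} = {})"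

end

theory Submission
  imports Defs
begin

text \<open>Call a clopen set \<open>Z\<close> ordinal-like if it carries a well-order whose sets \<open>{y. y < a}\<close> are open
  and \<open>{y. y \<le> a}\<close> closed in the space. Such sets form an ideal of clopen sets, so by compactness it
  suffices that every point has an ordinal-like clopen neighbourhood. If some point has none, then,
  the space being scattered, the set of such points has an isolated point \<open>p\<close>. Restricting to
  a small clopen neighbourhood of \<open>p\<close>, every clopen set missing \<open>p\<close> is ordinal-like.

  Cleaving \<open>{p}\<close> gives a chain \<open>\<F>\<close> of clopen sets, well-ordered by inclusion, with union the
  complement of \<open>p\<close>; it may be thinned out to have regular order type. For every bounded union
  \<open>V\<close> of members of \<open>\<F>\<close> that is not closed mark one point of \<open>cl V - V\<close>. Cleaving
  \<open>{p}\<close> together with the marked points gives a second chain \<open>\<G>\<close>. By regularity \<open>\<F>\<close> and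
  \<open>\<G>\<close> are mutually cofinal, so unless \<open>\<F>\<close> has order type \<open>\<omega>\<close>, arbitrarily large bounded
  sets \<open>V\<close> are unions of members of both. The chain \<open>\<G>\<close> cannot separate the points of
  \<open>cl V - V\<close>, hence only the marked point lies there, and \<open>cl V\<close> is clopen. The layers between
  consecutive closures are clopen or single points, and concatenating their well-orders orders the
  whole space.\<close>

subsection \<open>Well-orders and their order topology\<close>

text \<open>Least elements of singletons, pairs and triples yield reflexivity, totality and
  transitivity, so a construction only has to supply antisymmetry and least elements.\<close>

lemma Well_orderI_least:
  assumes sub: "r \<subseteq> Z \<times> Z" and anti: "antisym r"
    and least: "\<And>A. A \<subseteq> Z \<Longrightarrow> A \<noteq> {} \<Longrightarrow> \<exists>a\<in>A. \<forall>b\<in>A. (a, b) \<in> r"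
  shows "Well_order r" "Field r = Z"
proof -
  have refl: "(x, x) \<in> r" if "x \<in> Z" for x
    using least[of "{x}"] that by auto
  have total: "(x, y) \<in> r \<or> (y, x) \<in> r" if "x \<in> Z" "y \<in> Z" for x y
    using least[of "{x, y}"] that by auto
  show F: "Field r = Z"
    using sub refl by (auto simp: Field_def)
  have trans: "trans r"
  proof (rule transI)
    fix x y z assume xy: "(x, y) \<in> r" and yz: "(y, z) \<in> r"
    then have "{x, y, z} \<subseteq> Z" using sub by auto
    then obtain m where "m \<in> {x, y, z}" and m: "\<forall>b\<in>{x, y, z}. (m, b) \<in> r"
      using least[of "{x, y, z}"] by blast
    then consider "m = x" | "m = y" | "m = z" by blast
    then show "(x, z) \<in> r"
    proof cases
      case 2
      then have "x = y" using m xy anti by (auto dest: antisymD)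
      then show ?thesis using yz by simp
    next
      case 3
      then have "y = z" using m yz anti by (auto dest: antisymD)
      then show ?thesis using xy by simp
    qed (use m in auto)
  qed
  have lin: "Linear_order r"
    unfolding order_on_defs F refl_on_def total_on_def
    using sub refl total trans anti by auto
  show "Well_order r"
    unfolding well_order_on_def
    using lin Linear_order_wf_diff_Id[OF lin] least F by auto
qed

lemma Well_order_least:
  assumes "Well_order r" "A \<subseteq> Field r" "A \<noteq> {}"
  shows "\<exists>a\<in>A. \<forall>b\<in>A. (a, b) \<in> r"
  using assms Linear_order_wf_diff_Id[of r] by (simp add: well_order_on_def)

lemma Well_order_facts:
  assumes "Well_order r"
  shows "trans r" "antisym r" "\<And>x. x \<in> Field r \<Longrightarrow> (x, x) \<in> r"
    "\<And>x y. x \<in> Field r \<Longrightarrow> y \<in> Field r \<Longrightarrow> (x, y) \<notin> r \<Longrightarrow> (y, x) \<in> r"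
  using assms by (auto simp: order_on_defs refl_on_def total_on_def) (metis)

lemma topspace_ord_topology [simp]: "topspace (ord_topology r) = Field r"
  unfolding ord_topology_def topology_generated_by_topspace by (auto simp: Field_def)

lemma ord_topology_underS: "a \<in> Field r \<Longrightarrow> openin (ord_topology r) (underS r a)"
  unfolding ord_topology_def underS_def
  by (rule topology_generated_by_Basis) (auto simp: conj_commute)

lemma ord_topology_aboveS: "a \<in> Field r \<Longrightarrow> openin (ord_topology r) {b. (a, b) \<in> r \<and> b \<noteq> a}"
  unfolding ord_topology_def
  by (rule topology_generated_by_Basis) auto

lemma Field_diff_under:
  assumes "Well_order r" "a \<in> Field r"
  shows "Field r - under r a = {b. (a, b) \<in> r \<and> b \<noteq> a}"
  using Well_order_facts(2-4)[OF assms(1)] assms(2)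
  unfolding under_def by (auto dest: antisymD intro: FieldI2)

definition clopenin :: "'a topology \<Rightarrow> 'a set \<Rightarrow> bool" where
  "clopenin X S \<longleftrightarrow> openin X S \<and> closedin X S"

text \<open>Openness is where well-ordering enters: if \<open>a\<close> is not the last point, it
  has a successor \<open>b\<close>, and \<open>under r a\<close> is the open ray
  \<open>underS r b\<close>.\<close>

lemma clopenin_under:
  assumes "Well_order r" "a \<in> Field r"
  shows "clopenin (ord_topology r) (under r a)"
proof -
  have sub: "under r a \<subseteq> Field r" by (auto simp: under_def Field_def)
  have "openin (ord_topology r) (Field r - under r a)"
    unfolding Field_diff_under[OF assms] by (rule ord_topology_aboveS[OF assms(2)])
  then have cl: "closedin (ord_topology r) (under r a)"
    using sub by (simp add: closedin_def)
  have "openin (ord_topology r) (under r a)"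
  proof (cases "Field r - under r a = {}")
    case True
    then have "under r a = topspace (ord_topology r)" using sub by auto
    then show ?thesis by (metis openin_topspace)
  next
    case False
    then obtain b where b: "b \<in> Field r - under r a" "\<forall>c \<in> Field r - under r a. (b, c) \<in> r"
      using Well_order_least[OF assms(1), of "Field r - under r a"] by auto
    have "x \<in> under r a \<longleftrightarrow> x \<in> underS r b" for x
    proof (cases "x \<in> Field r")
      case True
      show ?thesis
      proof
        assume "x \<in> under r a"
        then have xa: "(x, a) \<in> r" by (simp add: under_def)
        have ba: "(b, a) \<notin> r" "b \<in> Field r" using b(1) by (auto simp: under_def)
        then have "(b, x) \<notin> r" using xa transD[OF Well_order_facts(1)[OF assms(1)]] by metis
        then show "x \<in> underS r b"
          using xa ba Well_order_facts(4)[OF assms(1) ba(2) True] by (auto simp: underS_def)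
      next
        assume "x \<in> underS r b"
        then have "x \<noteq> b" "(x, b) \<in> r" by (auto simp: underS_def)
        then have "(b, x) \<notin> r" using antisymD[OF Well_order_facts(2)[OF assms(1)]] by metis
        then show "x \<in> under r a" using b(2) True by auto
      qed
    qed (auto simp: under_def underS_def Field_def)
    then have "under r a = underS r b" by auto
    then show ?thesis using ord_topology_underS b by auto
  qed
  with cl show ?thesis by (simp add: clopenin_def)
qed

lemma Hausdorff_ord_topology:
  assumes "Well_order r"
  shows "Hausdorff_space (ord_topology r)"
proof -
  have sep: "\<exists>U V. openin (ord_topology r) U \<and> openin (ord_topology r) V \<and> x \<in> U \<and> y \<in> V \<and> disjnt U V"
    if "(x, y) \<in> r" "x \<noteq> y" for x y
  proof (intro exI conjI)
    have x: "x \<in> Field r" using that by (auto simp: Field_def)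
    show "openin (ord_topology r) (under r x)"
      using clopenin_under[OF assms x] by (simp add: clopenin_def)
    show "openin (ord_topology r) (Field r - under r x)"
      unfolding Field_diff_under[OF assms x] by (rule ord_topology_aboveS[OF x])
    show "x \<in> under r x"
      using Well_order_facts[OF assms] x by (simp add: under_def)
    show "y \<in> Field r - under r x"
      unfolding Field_diff_under[OF assms x] using that by simp
  qed (auto simp: disjnt_def)
  show ?thesis
    unfolding Hausdorff_space_def topspace_ord_topology
    using sep Well_order_facts(4)[OF assms] by (metis disjnt_sym)
qed

text \<open>For clopen \<open>Z\<close> the two conditions only make the order topology of
  \<open>s\<close> coarser than the given one. This one-sided form is easy to preserve under
  concatenation, and compactness later supplies the other side.\<close>

definition ordlike :: "'a topology \<Rightarrow> 'a set \<Rightarrow> bool" where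
  "ordlike X Z \<longleftrightarrow> (\<exists>s. Well_order s \<and> Field s = Z \<and>
     (\<forall>a\<in>Z. openin X (underS s a) \<and> closedin X (under s a)))"

text \<open>The identity is a continuous bijection from a compact space onto a Hausdorff
  space.\<close>

lemma ordlike_imp_homeomorphic:
  fixes X :: "'a topology"
  assumes "compact_space X" "ordlike X (topspace X)"
  shows "\<exists>s :: 'a rel. Well_order s \<and> X homeomorphic_space ord_topology (s :: 'a rel)"
proof -
  obtain s where s: "Well_order s" "Field s = topspace X"
    "\<forall>a\<in>topspace X. openin X (underS s a) \<and> closedin X (under s a)"
    using assms unfolding ordlike_def by blast
  have "continuous_map X (ord_topology s) id"
  proof -
    let ?B = "{Field s} \<union> {{y. (y, a) \<in> s \<and> y \<noteq> a} | a. a \<in> Field s}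
                \<union> {{y. (a, y) \<in> s \<and> y \<noteq> a} | a. a \<in> Field s}"
    have "openin X U" if U: "U \<in> ?B" for U
    proof -
      consider "U = Field s" | a where "a \<in> Field s" "U = {y. (y, a) \<in> s \<and> y \<noteq> a}"
        | a where "a \<in> Field s" "U = {y. (a, y) \<in> s \<and> y \<noteq> a}"
        using U by blast
      then show ?thesis
      proof cases
        case 2
        then have "U = underS s a" by (auto simp: underS_def)
        then show ?thesis using s 2 by auto
      next
        case 3
        then have "U = topspace X - under s a"
          using Field_diff_under[OF s(1)] s(2) by simp
        then show ?thesis using s 3 by auto
      qed (use s in auto)
    qed
    moreover have "U \<subseteq> topspace X" if "U \<in> ?B" for U
      using that s(2) by (auto simp: Field_def)
    ultimately show ?thesis
      unfolding ord_topology_def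
      by (intro continuous_on_generated_topo) (auto simp: Int_absorb2 s(2))
  qed
  then have "homeomorphic_map X (ord_topology s) id"
    using assms(1) Hausdorff_ord_topology[OF s(1)] s(2)
    by (intro continuous_imp_homeomorphic_map) auto
  then show ?thesis
    using s(1) homeomorphic_map_imp_homeomorphic_space by blast
qed

lemma ordlike_subset:
  assumes "ordlike X Z" "clopenin X Z'" "Z' \<subseteq> Z"
  shows "ordlike X Z'"
proof -
  obtain s where s: "Well_order s" "Field s = Z"
    "\<forall>a\<in>Z. openin X (underS s a) \<and> closedin X (under s a)"
    using assms unfolding ordlike_def by blast
  have "underS (Restr s Z') a = underS s a \<inter> Z'" "under (Restr s Z') a = under s a \<inter> Z'"
    if "a \<in> Z'" for a
    using that by (auto simp: underS_def under_def)
  moreover have "Field (Restr s Z') = Z'"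
    using s assms by (intro Refl_Field_Restr2) (auto simp: order_on_defs)
  ultimately show ?thesis
    unfolding ordlike_def
    using Well_order_Restr[OF s(1), of Z'] assms s(3)
    by (intro exI[of _ "Restr s Z'"] conjI ballI) (auto simp: clopenin_def)
qed

subsection \<open>Families well-ordered by inclusion\<close>

text \<open>This expresses well-ordering by inclusion without an order relation: a family that
  contains its own intersection has that intersection as least member. Two-member subfamilies give
  linearity.\<close>

definition wchain :: "'a set set \<Rightarrow> bool" where
  "wchain \<C> \<longleftrightarrow> (\<forall>\<S>\<subseteq>\<C>. \<S> \<noteq> {} \<longrightarrow> \<Inter>\<S> \<in> \<S>)"

lemma wchainD: "wchain \<C> \<Longrightarrow> \<S> \<subseteq> \<C> \<Longrightarrow> \<S> \<noteq> {} \<Longrightarrow> \<Inter>\<S> \<in> \<S>"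
  unfolding wchain_def by simp

lemma wchain_least:
  assumes "wchain \<C>" "C \<in> \<C>" "P C"
  obtains M where "M \<in> \<C>" "P M" "\<And>C. C \<in> \<C> \<Longrightarrow> P C \<Longrightarrow> M \<subseteq> C"
proof -
  have "\<Inter>{C \<in> \<C>. P C} \<in> {C \<in> \<C>. P C}"
    using assms by (intro wchainD) auto
  then show thesis by (intro that[of "\<Inter>{C \<in> \<C>. P C}"]) auto
qed

lemma wchain_linear:
  assumes "wchain \<C>" "C \<in> \<C>" "D \<in> \<C>"
  shows "C \<subseteq> D \<or> D \<subseteq> C"
proof -
  have "\<Inter>{C, D} \<in> {C, D}" using assms by (intro wchainD) auto
  then show ?thesis by auto
qed

lemma wchainI:
  assumes "\<And>\<S>. \<S> \<subseteq> \<C> \<Longrightarrow> \<S> \<noteq> {} \<Longrightarrow> \<exists>M\<in>\<S>. \<forall>S\<in>\<S>. M \<subseteq> S"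
  shows "wchain \<C>"
  unfolding wchain_def
proof (intro allI impI)
  fix \<S> assume S: "\<S> \<subseteq> \<C>" "\<S> \<noteq> {}"
  obtain M where M: "M \<in> \<S>" "\<forall>S\<in>\<S>. M \<subseteq> S" using assms[OF S] by blast
  then have "\<Inter>\<S> = M" by blast
  then show "\<Inter>\<S> \<in> \<S>" using M by simp
qed

lemma wchain_subset: "wchain \<C> \<Longrightarrow> \<D> \<subseteq> \<C> \<Longrightarrow> wchain \<D>"
  unfolding wchain_def by (meson order_trans)

lemma wchain_image:
  assumes "wchain \<C>" "\<And>C D. C \<in> \<C> \<Longrightarrow> D \<in> \<C> \<Longrightarrow> C \<subseteq> D \<Longrightarrow> h C \<subseteq> h D"
  shows "wchain (h ` \<C>)"
proof (rule wchainI)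
  fix \<S> assume S: "\<S> \<subseteq> h ` \<C>" "\<S> \<noteq> {}"
  then obtain C where C: "C \<in> \<C>" "h C \<in> \<S>" by blast
  obtain M where M: "M \<in> \<C>" "h M \<in> \<S>" "\<And>C. C \<in> \<C> \<Longrightarrow> h C \<in> \<S> \<Longrightarrow> M \<subseteq> C"
    using wchain_least[OF assms(1) C(1), where P = "\<lambda>C. h C \<in> \<S>"] C(2) by blast
  show "\<exists>M\<in>\<S>. \<forall>S\<in>\<S>. M \<subseteq> S"
  proof (intro bexI[of _ "h M"] ballI)
    fix S assume "S \<in> \<S>"
    then obtain C where "C \<in> \<C>" "S = h C" using S by blast
    then show "h M \<subseteq> S" using M assms(2) \<open>S \<in> \<S>\<close> by blast
  qed (rule M)
qed

lemma wchain_insert_top: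
  assumes "wchain \<C>" "\<And>C. C \<in> \<C> \<Longrightarrow> C \<subseteq> T"
  shows "wchain (insert T \<C>)"
proof (rule wchainI)
  fix \<S> assume S: "\<S> \<subseteq> insert T \<C>" "\<S> \<noteq> {}"
  show "\<exists>M\<in>\<S>. \<forall>S\<in>\<S>. M \<subseteq> S"
  proof (cases "\<S> \<inter> \<C> = {}")
    case True
    then have "\<S> = {T}" using S by blast
    then show ?thesis by blast
  next
    case False
    then obtain C where "C \<in> \<C>" "C \<in> \<S>" by blast
    then obtain M where M: "M \<in> \<C>" "M \<in> \<S>" "\<And>C. C \<in> \<C> \<Longrightarrow> C \<in> \<S> \<Longrightarrow> M \<subseteq> C"
      using wchain_least[OF assms(1), where P = "\<lambda>C. C \<in> \<S>"] by metis
    have "M \<subseteq> S" if "S \<in> \<S>" for S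
      using that S(1) M(3)[of S] assms(2)[OF M(1)] by (cases "S = T") auto
    then show ?thesis using M(2) by (intro bexI ballI)
  qed
qed

lemma wchain_induct [consumes 2, case_names step]:
  assumes "wchain \<C>" "C \<in> \<C>"
    and step: "\<And>C. C \<in> \<C> \<Longrightarrow> (\<And>D. D \<in> \<C> \<Longrightarrow> D \<subset> C \<Longrightarrow> P D) \<Longrightarrow> P C"
  shows "P C"
proof (rule ccontr)
  assume "\<not> P C"
  then obtain M where "M \<in> \<C>" "\<not> P M" "\<And>D. D \<in> \<C> \<Longrightarrow> \<not> P D \<Longrightarrow> M \<subseteq> D"
    using wchain_least[OF assms(1,2), where P = "\<lambda>C. \<not> P C"] by blast
  then show False using step[of M] by blast
qed

section \<open>Initial sections of a chain, including its limit stages\<close>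

definition chain_section :: "'a set set \<Rightarrow> 'a set \<Rightarrow> bool" where
  "chain_section \<C> V \<longleftrightarrow> (\<exists>\<W>\<subseteq>\<C>. V = \<Union>\<W>)"

lemma chain_section_Union: "(\<And>V. V \<in> \<V> \<Longrightarrow> chain_section \<C> V) \<Longrightarrow> chain_section \<C> (\<Union>\<V>)"
proof -
  assume *: "\<And>V. V \<in> \<V> \<Longrightarrow> chain_section \<C> V"
  have "x \<in> \<Union>{C \<in> \<C>. \<exists>V\<in>\<V>. C \<subseteq> V}" if V: "V \<in> \<V>" "x \<in> V" for x V
  proof -
    obtain \<W> where "\<W> \<subseteq> \<C>" "V = \<Union>\<W>" using *[OF V(1)] unfolding chain_section_def by auto
    then obtain W where "W \<in> \<C>" "x \<in> W" "W \<subseteq> V" using V(2) by auto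
    then show ?thesis using V(1) by auto
  qed
  then have "\<Union>\<V> = \<Union>{C \<in> \<C>. \<exists>V\<in>\<V>. C \<subseteq> V}" by auto
  then show ?thesis unfolding chain_section_def
    by (intro exI[of _ "{C \<in> \<C>. \<exists>V\<in>\<V>. C \<subseteq> V}"]) auto
qed

lemma chain_section_linear:
  assumes "wchain \<C>" "chain_section \<C> V" "C \<in> \<C>"
  shows "C \<subseteq> V \<or> V \<subseteq> C"
proof -
  obtain \<W> where "\<W> \<subseteq> \<C>" "V = \<Union>\<W>" using assms(2) unfolding chain_section_def by blast
  then show ?thesis using wchain_linear[OF assms(1) assms(3)] by blast
qed

lemma chain_section_between:
  assumes "wchain \<C>" "chain_section \<C> V" "chain_section \<C> W" "\<not> W \<subseteq> V"
  obtains C where "C \<in> \<C>" "\<not> C \<subseteq> V" "V \<subseteq> C" "C \<subseteq> W"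
proof -
  obtain C where "C \<in> \<C>" "\<not> C \<subseteq> V" "C \<subseteq> W"
    using assms(3,4) unfolding chain_section_def by blast
  then show thesis using chain_section_linear[OF assms(1,2)] that by blast
qed

text \<open>If some member of \<open>\<C>\<close> fails to lie in some section of
  \<open>\<S>\<close>, take the least such member \<open>M\<close>. A section of \<open>\<S>\<close>
  not containing \<open>M\<close> is least, since a smaller section would leave room for a member
  preceding \<open>M\<close>. If no member fails, all sections in \<open>\<S>\<close> equal
  \<open>\<Union>\<C>\<close>.\<close>

lemma wchain_sections:
  assumes "wchain \<C>"
  shows "wchain {V. chain_section \<C> V}"
proof (rule wchainI)
  fix \<S> assume S: "\<S> \<subseteq> {V. chain_section \<C> V}" "\<S> \<noteq> {}"
  show "\<exists>M\<in>\<S>. \<forall>S\<in>\<S>. M \<subseteq> S"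
  proof (cases "\<exists>V\<in>\<S>. \<exists>C\<in>\<C>. \<not> C \<subseteq> V")
    case False
    obtain V where V: "V \<in> \<S>" using S by blast
    have "V \<subseteq> W" if "W \<in> \<S>" for W
    proof -
      obtain \<W> where "\<W> \<subseteq> \<C>" "V = \<Union>\<W>" using V S(1) unfolding chain_section_def by auto
      then show ?thesis using False that by (auto simp: subset_iff; metis)
    qed
    then show ?thesis using V by (intro bexI ballI)
  next
    case True
    then obtain C where C: "C \<in> \<C>" "\<exists>V\<in>\<S>. \<not> C \<subseteq> V" by blast
    obtain M where M: "M \<in> \<C>" "\<exists>V\<in>\<S>. \<not> M \<subseteq> V"
      "\<And>C. C \<in> \<C> \<Longrightarrow> \<exists>V\<in>\<S>. \<not> C \<subseteq> V \<Longrightarrow> M \<subseteq> C"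
      using wchain_least[OF assms C(1), where P = "\<lambda>C. \<exists>V\<in>\<S>. \<not> C \<subseteq> V"] C(2) by metis
    then obtain V where V: "V \<in> \<S>" "\<not> M \<subseteq> V" by blast
    have "V \<subseteq> S" if S': "S \<in> \<S>" for S
    proof (rule ccontr)
      assume "\<not> V \<subseteq> S"
      moreover have "chain_section \<C> S" "chain_section \<C> V" using S(1) S' V(1) by auto
      ultimately obtain W where "W \<in> \<C>" "\<not> W \<subseteq> S" "W \<subseteq> V"
        using chain_section_between[OF assms, of S V] by metis
      then show False using M(3)[of W] S' V(2) by blast
    qed
    then show ?thesis using V(1) by (intro bexI ballI)
  qed
qed

subsection \<open>Concatenating well-orders\<close>

text \<open>The well-order is lexicographic: first by the least member of the chain containing the
  point, then by the order of the layer.\<close>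
lemma ordlike_filtration:
  fixes X :: "'a topology"
  assumes chain: "wchain \<W>" and clopen: "\<And>W. W \<in> \<W> \<Longrightarrow> clopenin X W"
    and layer: "\<And>W. W \<in> \<W> \<Longrightarrow>
      closedin X (\<Union>{W'\<in>\<W>. W' \<subset> W}) \<and> ordlike X (W - \<Union>{W'\<in>\<W>. W' \<subset> W}) \<or>
      (\<exists>y. W - \<Union>{W'\<in>\<W>. W' \<subset> W} \<subseteq> {y})"
  shows "ordlike X (\<Union>\<W>)"
proof -
  define pre where "pre W = \<Union>{W'\<in>\<W>. W' \<subset> W}" for W
  have pre_open: "openin X (pre W)" for W
    unfolding pre_def using clopen by (intro openin_Union) (auto simp: clopenin_def)
  \<comment> \<open>Each layer is ordered so that its initial segments behave well once
    \<open>pre W\<close> is put underneath them. The segments alone need not be open or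
    closed.\<close>
  have "\<exists>s. Well_order s \<and> Field s = W - pre W \<and>
     (\<forall>a\<in>W - pre W. openin X (pre W \<union> underS s a) \<and> closedin X (pre W \<union> under s a))"
    if W: "W \<in> \<W>" for W
  proof -
    from layer[OF W] consider "closedin X (pre W)" "ordlike X (W - pre W)"
      | y where "W - pre W = {y}" | "W - pre W = {}"
      unfolding pre_def[symmetric] by blast
    then show ?thesis
    proof cases
      case 1
      then show ?thesis using pre_open unfolding ordlike_def by blast
    next
      case 2
      \<comment> \<open>Here \<open>pre W\<close> need not be closed. It suffices that the strict
        segment gives \<open>pre W\<close>, which is open, and the full one gives \<open>W\<close>,
        which is clopen.\<close>
      then have "pre W \<union> {y} = W" unfolding pre_def by blast
      moreover have "Well_order {(y, y)}" "Field {(y, y)} = {y}"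
        by (rule Well_orderI_least[of _ "{y}"]; auto simp: antisym_def)+
      moreover have "underS {(y, y)} y = {}" "under {(y, y)} y = {y}"
        by (auto simp: underS_def under_def)
      ultimately show ?thesis using 2 pre_open clopen[OF W]
        by (intro exI[of _ "{(y, y)}"]) (simp add: clopenin_def)
    next
      case 3
      show ?thesis unfolding 3 by (intro exI[of _ "{}"]) simp
    qed
  qed
  then obtain s where s: "\<And>W. W \<in> \<W> \<Longrightarrow> Well_order (s W)"
    "\<And>W. W \<in> \<W> \<Longrightarrow> Field (s W) = W - pre W"
    "\<And>W a. W \<in> \<W> \<Longrightarrow> a \<in> W - pre W \<Longrightarrow> openin X (pre W \<union> underS (s W) a)"
    "\<And>W a. W \<in> \<W> \<Longrightarrow> a \<in> W - pre W \<Longrightarrow> closedin X (pre W \<union> under (s W) a)"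
    by metis
  \<comment> \<open>\<open>\<rho> x\<close> is the stage at which \<open>x\<close> enters the
    filtration.\<close>
  define \<rho> where "\<rho> x = \<Inter>{W\<in>\<W>. x \<in> W}" for x
  have \<rho>: "\<rho> x \<in> \<W>" "x \<in> \<rho> x" if "x \<in> \<Union>\<W>" for x
  proof -
    have "{W\<in>\<W>. x \<in> W} \<noteq> {}" using that by blast
    then have "\<rho> x \<in> {W\<in>\<W>. x \<in> W}"
      unfolding \<rho>_def by (intro wchainD[OF chain]) auto
    then show "\<rho> x \<in> \<W>" "x \<in> \<rho> x" by auto
  qed
  have \<rho>_least: "\<rho> x \<subseteq> W" if "W \<in> \<W>" "x \<in> W" for x W
    using that unfolding \<rho>_def by blast
  have \<rho>_less: "\<rho> x \<subset> W \<longleftrightarrow> x \<in> pre W" if "W \<in> \<W>" "x \<in> \<Union>\<W>" for x W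
  proof
    show "\<rho> x \<subset> W \<Longrightarrow> x \<in> pre W" using \<rho>[OF that(2)] unfolding pre_def by auto
    assume "x \<in> pre W"
    then obtain W' where "W' \<in> \<W>" "W' \<subset> W" "x \<in> W'" unfolding pre_def by auto
    then show "\<rho> x \<subset> W" using \<rho>_least[of W' x] by auto
  qed
  have \<rho>_eq: "\<rho> x = W \<longleftrightarrow> x \<in> W - pre W" if "W \<in> \<W>" "x \<in> \<Union>\<W>" for x W
    using \<rho>[OF that(2)] \<rho>_least[OF that(1), of x] \<rho>_less[OF that] by auto
  define r where "r = {(x, y). x \<in> \<Union>\<W> \<and> y \<in> \<Union>\<W> \<and> (\<rho> x \<subset> \<rho> y \<or> \<rho> x = \<rho> y \<and> (x, y) \<in> s (\<rho> x))}"
  have anti: "antisym r"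
  proof (rule antisymI)
    fix x y assume xy: "(x, y) \<in> r" "(y, x) \<in> r"
    then have "\<rho> x = \<rho> y" "(x, y) \<in> s (\<rho> x)" "(y, x) \<in> s (\<rho> x)" "\<rho> x \<in> \<W>"
      using \<rho> unfolding r_def by auto
    then show "x = y" using s(1) Well_order_facts(2) antisymD by metis
  qed
  have least: "\<exists>a\<in>A. \<forall>b\<in>A. (a, b) \<in> r" if A: "A \<subseteq> \<Union>\<W>" "A \<noteq> {}" for A
  proof -
    \<comment> \<open>Minimise the entry stage first, then minimise inside the layer of that
      stage.\<close>
    have "\<rho> ` A \<subseteq> \<W>" "\<rho> ` A \<noteq> {}" using A \<rho> by auto
    then have "\<Inter>(\<rho> ` A) \<in> \<rho> ` A" by (rule wchainD[OF chain])
    then obtain c where c: "c \<in> A" "\<Inter>(\<rho> ` A) = \<rho> c" by auto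
    then have c: "c \<in> A" "\<And>b. b \<in> A \<Longrightarrow> \<rho> c \<subseteq> \<rho> b" by blast+
    have cW: "\<rho> c \<in> \<W>" using c A \<rho> by blast
    have sub: "{b \<in> A. \<rho> b = \<rho> c} \<subseteq> Field (s (\<rho> c))"
      unfolding s(2)[OF cW] using \<rho>_eq[OF cW] subsetD[OF A(1)] by blast
    have ne: "{b \<in> A. \<rho> b = \<rho> c} \<noteq> {}" using c(1) by auto
    obtain a where "a \<in> {b \<in> A. \<rho> b = \<rho> c}"
      "\<forall>b\<in>{b \<in> A. \<rho> b = \<rho> c}. (a, b) \<in> s (\<rho> c)"
      using Well_order_least[OF s(1)[OF cW] sub ne] by (elim bexE)
    then have a: "a \<in> A" "\<rho> a = \<rho> c" "\<And>b. b \<in> A \<Longrightarrow> \<rho> b = \<rho> c \<Longrightarrow> (a, b) \<in> s (\<rho> c)"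
      by auto
    have "(a, b) \<in> r" if "b \<in> A" for b
    proof (cases "\<rho> b = \<rho> c")
      case True
      then show ?thesis using a that A(1) unfolding r_def by auto
    next
      case False
      then show ?thesis using a(1,2) c(2)[OF that] that A(1) unfolding r_def by auto
    qed
    then show ?thesis using a by blast
  qed
  have r: "Well_order r" "Field r = \<Union>\<W>"
    by (rule Well_orderI_least[OF _ anti least]; auto simp: r_def)+
  have "openin X (underS r a) \<and> closedin X (under r a)" if a: "a \<in> \<Union>\<W>" for a
  proof -
    let ?W = "\<rho> a"
    note W = \<rho>(1)[OF a]
    have aW: "a \<in> ?W - pre ?W" using \<rho>_eq[OF W a] by blast
    have field: "x \<in> \<Union>\<W> \<and> \<rho> x = ?W" if "(x, a) \<in> s ?W" for x
    proof -
      have "x \<in> ?W - pre ?W" using s(2)[OF W] that by (auto simp: Field_def)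
      then show ?thesis using \<rho>_eq[OF W, of x] W by auto
    qed
    have sub: "pre ?W \<subseteq> \<Union>\<W>" unfolding pre_def by blast
    \<comment> \<open>A segment ending at \<open>a\<close> consists of all that entered before
      \<open>a\<close>, followed by a segment of the layer of \<open>a\<close>. This reduces its
      openness or closedness to the choice of \<open>s\<close>.\<close>
    have iff: "(x, a) \<in> r \<longleftrightarrow> x \<in> pre ?W \<or> (x, a) \<in> s ?W" for x
    proof
      assume "(x, a) \<in> r"
      then have "x \<in> \<Union>\<W>" "\<rho> x \<subset> ?W \<or> (x, a) \<in> s ?W" unfolding r_def by auto
      then show "x \<in> pre ?W \<or> (x, a) \<in> s ?W" using \<rho>_less[OF W] by blast
    next
      assume "x \<in> pre ?W \<or> (x, a) \<in> s ?W"
      then have "x \<in> \<Union>\<W>" "\<rho> x \<subset> ?W \<or> \<rho> x = ?W \<and> (x, a) \<in> s ?W"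
        using \<rho>_less[OF W] field[of x] sub by blast+
      then show "(x, a) \<in> r" using a unfolding r_def by auto
    qed
    have "underS r a = pre ?W \<union> underS (s ?W) a"
      using aW by (auto simp: underS_def iff)
    moreover have "under r a = pre ?W \<union> under (s ?W) a"
      by (auto simp: under_def iff)
    ultimately show ?thesis using s(3,4)[OF W aW] by simp
  qed
  then show ?thesis unfolding ordlike_def using r by blast
qed

text \<open>Use the filtration with stages \<open>A\<close> and \<open>A \<union> B\<close>, whose
  second layer is the clopen set \<open>B - A\<close>. The case in which both stages coincide is
  split off.\<close>

lemma ordlike_Un:
  assumes "ordlike X A" "ordlike X B" "clopenin X A" "clopenin X B"
  shows "ordlike X (A \<union> B)"
proof (cases "B \<subseteq> A")
  case True
  then show ?thesis using assms(1) by (simp add: Un_absorb2)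
next
  case False
  let ?W = "{A, A \<union> B}"
  have "ordlike X (\<Union>?W)"
  proof (rule ordlike_filtration)
    show "wchain ?W"
    proof (rule wchainI)
      fix S assume S: "S \<subseteq> ?W" "S \<noteq> {}"
      show "\<exists>M\<in>S. \<forall>T\<in>S. M \<subseteq> T"
      proof (cases "A \<in> S")
        case True
        then show ?thesis using S(1) by (intro bexI[of _ A]) auto
      next
        case False
        then have "S = {A \<union> B}" using S by auto
        then show ?thesis by simp
      qed
    qed
  next
    fix W assume W: "W \<in> ?W"
    then show "clopenin X W" using assms by (auto simp: clopenin_def)
    show "closedin X (\<Union>{W'\<in>?W. W' \<subset> W}) \<and> ordlike X (W - \<Union>{W'\<in>?W. W' \<subset> W}) \<or>
      (\<exists>y. W - \<Union>{W'\<in>?W. W' \<subset> W} \<subseteq> {y})"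
    proof (cases "W = A")
      case True
      then have "{W'\<in>?W. W' \<subset> W} = {}" by auto
      then show ?thesis using True assms(1) by (metis Diff_empty Union_empty closedin_empty)
    next
      case nA: False
      then have "{W'\<in>?W. W' \<subset> W} = {A}" "W = A \<union> B" using W False by auto
      then have eq: "\<Union>{W'\<in>?W. W' \<subset> W} = A" "W - A = B - A" by auto
      have "clopenin X (B - A)" using assms by (auto simp: clopenin_def)
      then have "ordlike X (B - A)" using ordlike_subset[OF assms(2)] by auto
      then show ?thesis unfolding eq using assms(3) by (simp add: clopenin_def)
    qed
  qed
  then show ?thesis by (simp add: Un_absorb1)
qed

lemma ordlike_clopen_cover:
  assumes "finite \<U>" "\<And>U. U \<in> \<U> \<Longrightarrow> clopenin X U \<and> ordlike X U"
  shows "clopenin X (\<Union>\<U>) \<and> ordlike X (\<Union>\<U>)"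
  using assms
proof (induction \<U>)
  case empty
  have "ordlike X {}" unfolding ordlike_def by (intro exI[of _ "{}"]) simp
  then show ?case by (simp add: clopenin_def)
next
  case (insert U \<U>)
  then have "clopenin X U" "ordlike X U" "clopenin X (\<Union>\<U>)" "ordlike X (\<Union>\<U>)" by auto
  then show ?case using ordlike_Un[of X U "\<Union>\<U>"] by (auto simp: clopenin_def)
qed

lemma ordlike_singleton:
  assumes "clopenin X {x}"
  shows "ordlike X {x}"
proof -
  have "ordlike X (\<Union>{{x}})"
  proof (rule ordlike_filtration)
    show "wchain {{x}}" by (rule wchainI) blast
  qed (use assms in auto)
  then show ?thesis by simp
qed

text \<open>A nonempty finite subcover by members of a chain has a largest member, which covers
  alone. An empty subcover is handled by \<open>\<C> \<noteq> {}\<close>.\<close>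

lemma wchain_compact_cover:
  assumes "wchain \<C>" "\<C> \<noteq> {}" "\<And>C. C \<in> \<C> \<Longrightarrow> openin X C" "compactin X K" "K \<subseteq> \<Union>\<C>"
  obtains C where "C \<in> \<C>" "K \<subseteq> C"
proof -
  obtain \<F> where F: "finite \<F>" "\<F> \<subseteq> \<C>" "K \<subseteq> \<Union>\<F>"
    using assms(3-5) unfolding compactin_def by metis
  have "\<exists>C\<in>\<C>. \<Union>\<F> \<subseteq> C" using F(1,2)
  proof (induction \<F>)
    case empty
    then show ?case using assms(2) by auto
  next
    case (insert D \<F>)
    then obtain C where C: "C \<in> \<C>" "\<Union>\<F> \<subseteq> C" by auto
    have "D \<in> \<C>" using insert.prems by auto
    then consider "C \<subseteq> D" | "D \<subseteq> C" using C(1) wchain_linear[OF assms(1)] by auto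
    then show ?case
    proof cases
      case 1
      then show ?thesis using C \<open>D \<in> \<C>\<close> by (intro bexI[of _ D]) auto
    next
      case 2
      then show ?thesis using C by (intro bexI[of _ C]) auto
    qed
  qed
  then obtain C where "C \<in> \<C>" "\<Union>\<F> \<subseteq> C" by auto
  then show thesis using that[of C] F(3) by auto
qed

subsection \<open>Cleaving by chains of clopen sets\<close>

text \<open>This is the trace of a cleaving map inside the space: the chain replaces the map and its
  codomain, and \<open>p\<close> sits beyond all members. Points lying in every member are exempt
  from separation.\<close>

definition chain_cleavable :: "'a topology \<Rightarrow> bool" where
  "chain_cleavable X \<longleftrightarrow> (\<forall>A p. p \<in> A \<longrightarrow> A \<subseteq> topspace X \<longrightarrow>
     (\<exists>\<C>. \<C> \<noteq> {} \<and> wchain \<C> \<and> (\<forall>C\<in>\<C>. clopenin X C \<and> p \<notin> C) \<and>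
       (\<forall>x\<in>A. \<forall>y\<in>topspace X - A. (\<forall>C\<in>\<C>. x \<in> C \<longleftrightarrow> y \<in> C) \<longrightarrow> (\<forall>C\<in>\<C>. x \<in> C))))"

lemma chain_cleavableD:
  assumes "chain_cleavable X" "p \<in> A" "A \<subseteq> topspace X"
  shows "\<exists>\<C>. \<C> \<noteq> {} \<and> wchain \<C> \<and> (\<forall>C\<in>\<C>. clopenin X C \<and> p \<notin> C) \<and>
    (\<forall>x\<in>A. \<forall>y\<in>topspace X - A. (\<forall>C\<in>\<C>. x \<in> C \<longleftrightarrow> y \<in> C) \<longrightarrow> (\<forall>C\<in>\<C>. x \<in> C))"
  using assms(1)[unfolded chain_cleavable_def, THEN spec, THEN spec, THEN mp, OF assms(2),
      THEN mp, OF assms(3)] .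

text \<open>The chain consists of the preimages of the complements of the intervals
  \<open>[0, f p]\<close> and \<open>(\<delta>, f p]\<close>; points sent above \<open>f p\<close> become indistinguishable, whence the exception in
  the definition.\<close>
lemma cleavable_over_imp_chain_cleavable:
  assumes r: "Well_order r" and cl: "cleavable_over X (ord_topology r)"
  shows "chain_cleavable X"
  unfolding chain_cleavable_def
proof (intro allI impI)
  fix A p assume p: "p \<in> A" and A: "A \<subseteq> topspace X"
  obtain f where f: "continuous_map X (ord_topology r) f" "f ` A \<inter> f ` (topspace X - A) = {}"
    using cl A unfolding cleavable_over_def by metis
  have fF: "f x \<in> Field r" if "x \<in> topspace X" for x
    using continuous_map_image_subset_topspace[OF f(1)] that by auto
  note r_facts = Well_order_facts[OF r]
  define N where "N d = {x \<in> topspace X. f x \<in> under r d}" for d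
  have N: "clopenin X (N d)" if "d \<in> Field r" for d
    using clopenin_under[OF r that] openin_continuous_map_preimage[OF f(1)]
      closedin_continuous_map_preimage[OF f(1)]
    unfolding N_def clopenin_def by auto
  have N_mono: "N d \<subseteq> N e" if "(d, e) \<in> r" for d e
    using that r_facts(1) unfolding N_def under_def by (auto dest: transD)
  have pX: "p \<in> topspace X" using p A by auto
  define D where "D = {d \<in> Field r. (d, f p) \<in> r \<and> d \<noteq> f p}"
  define Q where "Q = topspace X - N (f p)"
  define \<C> where "\<C> = insert Q ((\<lambda>d. Q \<union> N d) ` D)"
  have Q: "clopenin X Q"
    using N[OF fF[OF pX]] unfolding Q_def clopenin_def by auto
  have pN: "p \<in> N (f p)" using r_facts(3)[OF fF[OF pX]] pX unfolding N_def under_def by auto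
  show "\<exists>\<C>. \<C> \<noteq> {} \<and> wchain \<C> \<and> (\<forall>C\<in>\<C>. clopenin X C \<and> p \<notin> C) \<and>
       (\<forall>x\<in>A. \<forall>y\<in>topspace X - A. (\<forall>C\<in>\<C>. x \<in> C \<longleftrightarrow> y \<in> C) \<longrightarrow> (\<forall>C\<in>\<C>. x \<in> C))"
  proof (intro exI conjI ballI impI)
    show "\<C> \<noteq> {}" unfolding \<C>_def by simp
    show "wchain \<C>"
    proof (rule wchainI)
      fix S assume S: "S \<subseteq> \<C>" "S \<noteq> {}"
      show "\<exists>M\<in>S. \<forall>T\<in>S. M \<subseteq> T"
      proof (cases "Q \<in> S")
        case True
        then show ?thesis using S(1) unfolding \<C>_def by (intro bexI[of _ Q]) auto
      next
        case False
        let ?E = "{d \<in> D. Q \<union> N d \<in> S}"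
        obtain T where "T \<in> S" using S(2) by auto
        then have ne: "?E \<noteq> {}" using S(1) False unfolding \<C>_def by auto
        have sub: "?E \<subseteq> Field r" unfolding D_def by auto
        obtain m where m: "m \<in> ?E" "\<forall>d\<in>?E. (m, d) \<in> r"
          using Well_order_least[OF r sub ne] by (elim bexE)
        have "Q \<union> N m \<subseteq> T" if T: "T \<in> S" for T
        proof -
          obtain d where d: "d \<in> ?E" "T = Q \<union> N d" using T S(1) False unfolding \<C>_def by auto
          then show ?thesis using N_mono[OF bspec[OF m(2) d(1)]] by auto
        qed
        then show ?thesis using m(1) by (intro bexI[of _ "Q \<union> N m"]) auto
      qed
    qed
  next
    fix C assume C: "C \<in> \<C>"
    show "clopenin X C"
      using C Q N unfolding \<C>_def D_def clopenin_def by auto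
    have "p \<notin> N d" if "d \<in> D" for d
      using that r_facts(2) unfolding N_def under_def D_def by (auto dest: antisymD)
    then show "p \<notin> C" using C pN unfolding \<C>_def Q_def by auto
  next
    fix x y C assume x: "x \<in> A" and y: "y \<in> topspace X - A"
      and eq: "\<forall>C\<in>\<C>. x \<in> C \<longleftrightarrow> y \<in> C" and C: "C \<in> \<C>"
    have ne: "f x \<noteq> f y" using f(2) x y by auto
    have xX: "x \<in> topspace X" using x A by auto
    \<comment> \<open>If \<open>f u\<close> is below \<open>f v\<close> and \<open>f v\<close> is at
      most \<open>f p\<close>, then the member \<open>Q \<union> N (f u)\<close> contains
      \<open>u\<close> but not \<open>v\<close>. Hence, of two points the chain cannot tell apart,
      the one with the larger value is sent above \<open>f p\<close>.\<close>
    have less: "v \<in> Q"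
      if uv: "u \<in> topspace X" "v \<in> topspace X" "f u \<noteq> f v" "(f u, f v) \<in> r"
        "\<forall>C\<in>\<C>. u \<in> C \<longleftrightarrow> v \<in> C" for u v
    proof (rule ccontr)
      assume vQ: "v \<notin> Q"
      then have vp: "(f v, f p) \<in> r" using uv(2) unfolding Q_def N_def under_def by auto
      have vu: "(f v, f u) \<notin> r" using uv(3,4) antisymD[OF r_facts(2)] by metis
      have "(f u, f p) \<in> r" using transD[OF r_facts(1) uv(4) vp] .
      moreover have "f u \<noteq> f p" using vp vu by metis
      ultimately have "f u \<in> D" using fF[OF uv(1)] unfolding D_def by simp
      then have "Q \<union> N (f u) \<in> \<C>" unfolding \<C>_def by simp
      moreover have "u \<in> N (f u)"
        using uv(1) r_facts(3)[OF fF[OF uv(1)]] unfolding N_def under_def by simp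
      ultimately have "v \<in> Q \<union> N (f u)" using uv(5) by (metis UnCI)
      then show False using vQ vu unfolding N_def under_def by simp
    qed
    \<comment> \<open>\<open>Q\<close> is itself a member, so both points lie in it as soon as one
      does; and \<open>Q\<close> is contained in every member.\<close>
    have "x \<in> Q \<longleftrightarrow> y \<in> Q" using eq unfolding \<C>_def by auto
    moreover have "x \<in> Q \<or> y \<in> Q"
    proof (cases "(f x, f y) \<in> r")
      case True
      then show ?thesis using less[of x y] xX y ne eq by simp
    next
      case False
      then have "(f y, f x) \<in> r" using r_facts(4) fF xX y by simp
      then show ?thesis using less[of y x] xX y ne[symmetric] eq by simp
    qed
    ultimately have "x \<in> Q" by simp
    then show "x \<in> C" using C unfolding \<C>_def by auto
  qed
qed

text \<open>Regularity of the cofinality, stated without ordinals: families of members indexed by a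
  proper initial segment of \<open>\<D>\<close> are bounded. The reason is that such a segment has
  fewer elements than any cofinal subfamily.\<close>

lemma regular_subchain:
  includes cardinal_syntax
  assumes chain: "wchain \<C>"
  shows "\<exists>\<D>\<subseteq>\<C>. (\<forall>C\<in>\<C>. \<exists>D\<in>\<D>. C \<subseteq> D) \<and>
    (\<forall>D\<in>\<D>. \<forall>h. (\<forall>E\<in>\<D>. E \<subset> D \<longrightarrow> h E \<in> \<C>) \<longrightarrow> (\<exists>M\<in>\<D>. \<forall>E\<in>\<D>. E \<subset> D \<longrightarrow> h E \<subseteq> M))"
proof -
  define cof where "cof \<K> \<longleftrightarrow> \<K> \<subseteq> \<C> \<and> (\<forall>C\<in>\<C>. \<exists>K\<in>\<K>. C \<subseteq> K)" for \<K>
  have "cof \<C>" unfolding cof_def by auto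
  then have "card_of ` {\<K>. cof \<K>} \<noteq> {}" by auto
  moreover have "\<forall>r\<in>card_of ` {\<K>. cof \<K>}. Card_order r" by (auto intro: card_of_Card_order)
  ultimately obtain r where "r \<in> card_of ` {\<K>. cof \<K>}" "\<forall>r'\<in>card_of ` {\<K>. cof \<K>}. r \<le>o r'"
    using exists_minim_Card_order by (metis (no_types, lifting))
  then obtain \<K> where K: "cof \<K>" "\<And>\<K>'. cof \<K>' \<Longrightarrow> |\<K>| \<le>o |\<K>'|" by auto
  let ?r = "|\<K>|"
  have wo: "Well_order ?r" by (rule card_of_Well_order)
  have fld: "Field ?r = \<K>" by (rule Field_card_of)
  \<comment> \<open>Enumerate a cofinal family of least cardinality along its cardinal order and
    keep the members that contain all earlier ones. On these, inclusion follows the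
    enumeration.\<close>
  define \<D> where "\<D> = {K \<in> \<K>. \<forall>J. J \<in> underS ?r K \<longrightarrow> J \<subseteq> K}"
  have KC: "\<K> \<subseteq> \<C>" using K(1) unfolding cof_def by simp
  have cofD: "\<exists>D\<in>\<D>. C \<subseteq> D" if C: "C \<in> \<C>" for C
  proof -
    let ?S = "{K \<in> \<K>. C \<subseteq> K}"
    have sub: "?S \<subseteq> Field ?r" and ne: "?S \<noteq> {}"
      using K(1) C unfolding fld cof_def by auto
    obtain k where k: "k \<in> ?S" "\<forall>j\<in>?S. (k, j) \<in> ?r"
      using Well_order_least[OF wo sub ne] by (elim bexE)
    \<comment> \<open>\<open>k\<close> is the first member in the enumeration containing
      \<open>C\<close>. Earlier ones do not contain \<open>C\<close>, so by linearity they lie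
      inside \<open>C\<close> and hence inside \<open>k\<close>.\<close>
    have "j \<subseteq> k" if j: "j \<in> underS ?r k" for j
    proof -
      have jk: "(j, k) \<in> ?r" "j \<noteq> k" using j by (auto simp: underS_def)
      then have jK: "j \<in> \<K>" using fld FieldI1 by fastforce
      have "(k, j) \<notin> ?r" using jk antisymD[OF Well_order_facts(2)[OF wo]] by metis
      then have "\<not> C \<subseteq> j" using k(2) jK by auto
      then have "j \<subseteq> C" using wchain_linear[OF chain, of C j] C jK KC by auto
      then show ?thesis using k(1) by auto
    qed
    then have "k \<in> \<D>" using k(1) unfolding \<D>_def by simp
    then show ?thesis using k(1) by auto
  qed
  have "\<exists>M\<in>\<D>. \<forall>E\<in>\<D>. E \<subset> D \<longrightarrow> h E \<subseteq> M"
    if D: "D \<in> \<D>" and h: "\<forall>E\<in>\<D>. E \<subset> D \<longrightarrow> h E \<in> \<C>" for D h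
  proof -
    let ?B = "{E \<in> \<D>. E \<subset> D}"
    have DK: "D \<in> Field ?r" using D fld unfolding \<D>_def by simp
    \<comment> \<open>Members properly inside \<open>D\<close> were enumerated before
      \<open>D\<close>, so there are fewer than \<open>|\<K>|\<close> of them.\<close>
    have "?B \<subseteq> underS ?r D"
    proof
      fix E assume E: "E \<in> ?B"
      then have EK: "E \<in> Field ?r" using fld unfolding \<D>_def by simp
      show "E \<in> underS ?r D"
      proof (rule ccontr)
        assume "E \<notin> underS ?r D"
        then have "(E, D) \<notin> ?r" using E by (auto simp: underS_def)
        then have "(D, E) \<in> ?r" using Well_order_facts(4)[OF wo EK DK] by simp
        then have "D \<in> underS ?r E" using E by (auto simp: underS_def)
        then have "D \<subseteq> E" using E unfolding \<D>_def by simp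
        then show False using E by auto
      qed
    qed
    then have "|?B| \<le>o |underS ?r D|" by (rule card_of_mono1)
    moreover have "|underS ?r D| <o ?r" by (rule card_of_underS[OF card_of_Card_order DK])
    moreover have "|h ` ?B| \<le>o |?B|" by (rule card_of_image)
    ultimately have "|h ` ?B| <o ?r" by (meson ordLeq_transitive ordLeq_ordLess_trans)
    \<comment> \<open>The image is too small to be cofinal. Some \<open>C\<close> is contained in no
      \<open>h E\<close>, and by linearity it contains them all.\<close>
    then have "\<not> cof (h ` ?B)" using K(2) not_ordLess_ordLeq by metis
    moreover have "h ` ?B \<subseteq> \<C>" using h by auto
    ultimately obtain C where C: "C \<in> \<C>" "\<forall>K\<in>h ` ?B. \<not> C \<subseteq> K"
      unfolding cof_def by (meson)
    obtain M where M: "M \<in> \<D>" "C \<subseteq> M" using cofD[OF C(1)] by (elim bexE)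
    have "h E \<subseteq> M" if E: "E \<in> \<D>" "E \<subset> D" for E
    proof -
      have "\<not> C \<subseteq> h E" using C(2) E by simp
      moreover have "h E \<in> \<C>" using h E by simp
      ultimately show ?thesis using wchain_linear[OF chain C(1), of "h E"] M(2) by auto
    qed
    then show ?thesis using M(1) by auto
  qed
  moreover have "\<D> \<subseteq> \<C>" using KC unfolding \<D>_def by auto
  ultimately show ?thesis using cofD by (intro exI[of _ \<D>]) simp
qed

text \<open>Adding the whole space on top turns the exhaustion into a filtration with last layer
  \<open>{p}\<close>. A layer over a closed stage is clopen and misses \<open>p\<close>, so
  \<open>good\<close> orders it.\<close>

lemma ordlike_exhaustion:
  assumes chain: "wchain \<W>" and clopen: "\<And>W. W \<in> \<W> \<Longrightarrow> clopenin X W"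
    and p: "p \<in> topspace X" and cover: "\<Union>\<W> = topspace X - {p}"
    and good: "\<And>Z. clopenin X Z \<Longrightarrow> p \<notin> Z \<Longrightarrow> ordlike X Z"
    and layer: "\<And>W. W \<in> \<W> \<Longrightarrow> closedin X (\<Union>{W'\<in>\<W>. W' \<subset> W}) \<or>
      (\<exists>y. W - \<Union>{W'\<in>\<W>. W' \<subset> W} \<subseteq> {y})"
  shows "ordlike X (topspace X)"
proof -
  let ?T = "topspace X"
  let ?W = "insert ?T \<W>"
  have sub: "W \<subseteq> ?T - {p}" if "W \<in> \<W>" for W using cover that by blast
  have "ordlike X (\<Union>?W)"
  proof (rule ordlike_filtration)
    show "wchain ?W" using chain sub by (intro wchain_insert_top) auto
    fix W assume W: "W \<in> ?W"
    then show "clopenin X W" using clopen by (auto simp: clopenin_def)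
    show "closedin X (\<Union>{W'\<in>?W. W' \<subset> W}) \<and> ordlike X (W - \<Union>{W'\<in>?W. W' \<subset> W}) \<or>
      (\<exists>y. W - \<Union>{W'\<in>?W. W' \<subset> W} \<subseteq> {y})"
    proof (cases "W = ?T")
      case True
      have "{W'\<in>?W. W' \<subset> W} = \<W>" using sub p True by auto
      moreover have "W - \<Union>\<W> = {p}" unfolding cover True using p by auto
      ultimately show ?thesis by simp
    next
      case False
      then have WW: "W \<in> \<W>" using W by simp
      have eq: "{W'\<in>?W. W' \<subset> W} = {W'\<in>\<W>. W' \<subset> W}" using sub[OF WW] by auto
      have "ordlike X (W - \<Union>{W'\<in>\<W>. W' \<subset> W})" if cl: "closedin X (\<Union>{W'\<in>\<W>. W' \<subset> W})"
      proof (rule good)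
        have "openin X (\<Union>{W'\<in>\<W>. W' \<subset> W})"
          using clopen by (intro openin_Union) (auto simp: clopenin_def)
        then show "clopenin X (W - \<Union>{W'\<in>\<W>. W' \<subset> W})"
          using clopen[OF WW] cl unfolding clopenin_def by (simp add: openin_diff closedin_diff)
        show "p \<notin> W - \<Union>{W'\<in>\<W>. W' \<subset> W}" using sub[OF WW] by auto
      qed
      then show ?thesis unfolding eq using layer[OF WW] by blast
    qed
  qed
  moreover have "\<Union>?W = ?T" using cover by auto
  ultimately show ?thesis by simp
qed

subsection \<open>Two cleaving chains at a point\<close>

definition boundary_point :: "'a topology \<Rightarrow> 'a set \<Rightarrow> 'a" where
  "boundary_point X V = (SOME v. v \<in> X closure_of V - V)"

lemma boundary_point:
  assumes "V \<subseteq> topspace X" "\<not> closedin X V"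
  shows "boundary_point X V \<in> X closure_of V - V"
proof -
  have "\<not> X closure_of V \<subseteq> V" using assms closure_of_subset_eq by metis
  then have "\<exists>v. v \<in> X closure_of V - V" by auto
  then show ?thesis unfolding boundary_point_def by (rule someI_ex)
qed

text \<open>A chain cleaving this set has to distinguish the chosen boundary point of each bounded
  section from unmarked points near it. \<open>p\<close> is included because
  \<open>chain_cleavable\<close> works relative to a point of the cleaved set.\<close>

definition marked_points :: "'a topology \<Rightarrow> 'a \<Rightarrow> 'a set set \<Rightarrow> 'a set" where
  "marked_points X p \<F> = insert p {boundary_point X V | V.
     chain_section \<F> V \<and> V \<noteq> topspace X - {p} \<and> \<not> closedin X V}"

locale cleaving_chains =
  fixes X :: "'a topology" and p :: 'a and \<F> \<G> :: "'a set set"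
  assumes compact: "compact_space X" and p: "p \<in> topspace X" and not_isolated: "\<not> openin X {p}"
    and F_chain: "wchain \<F>" and F_clopen: "\<And>C. C \<in> \<F> \<Longrightarrow> clopenin X C"
    and F_cover: "\<Union>\<F> = topspace X - {p}"
    and F_regular: "\<And>C h. C \<in> \<F> \<Longrightarrow> (\<And>D. D \<in> \<F> \<Longrightarrow> D \<subset> C \<Longrightarrow> h D \<in> \<F>) \<Longrightarrow>
      \<exists>M\<in>\<F>. \<forall>D\<in>\<F>. D \<subset> C \<longrightarrow> h D \<subseteq> M"
    and G_chain: "wchain \<G>" and G_nonempty: "\<G> \<noteq> {}"
    and G_clopen: "\<And>G. G \<in> \<G> \<Longrightarrow> clopenin X G" and G_avoids: "\<And>G. G \<in> \<G> \<Longrightarrow> p \<notin> G"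
    and G_separates: "\<And>x y. x \<in> marked_points X p \<F> \<Longrightarrow> y \<in> topspace X \<Longrightarrow>
      y \<notin> marked_points X p \<F> \<Longrightarrow> (\<And>G. G \<in> \<G> \<Longrightarrow> x \<in> G \<longleftrightarrow> y \<in> G) \<Longrightarrow> (\<forall>G\<in>\<G>. x \<in> G)"
begin

abbreviation U where "U \<equiv> topspace X - {p}"

text \<open>Since \<open>p\<close> is not isolated, \<open>U\<close> is not closed. Hence every
  member of either chain is a proper part of \<open>U\<close>, and \<open>\<F>\<close> has no last
  member.\<close>

lemma clopen_neq_U: "clopenin X S \<Longrightarrow> S \<noteq> U"
proof
  assume "clopenin X S" "S = U"
  then have "openin X (topspace X - U)" unfolding clopenin_def by blast
  moreover have "topspace X - U = {p}" using p by auto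
  ultimately show False using not_isolated by simp
qed

lemma clopen_compact: "clopenin X S \<Longrightarrow> compactin X S"
  using compact closedin_compact_space unfolding clopenin_def by blast

lemma F_subset: "C \<in> \<F> \<Longrightarrow> C \<subseteq> U"
  using F_cover by blast

lemma F_openin: "C \<in> \<F> \<Longrightarrow> openin X C" and G_openin: "G \<in> \<G> \<Longrightarrow> openin X G"
  using F_clopen G_clopen by (auto simp: clopenin_def)

lemma F_nonempty: "\<F> \<noteq> {}"
  using F_cover clopen_neq_U[of "{}"] by (auto simp: clopenin_def)

lemma G_subset: "G \<in> \<G> \<Longrightarrow> G \<subseteq> U"
  using G_clopen[of G] G_avoids[of G] closedin_subset[of X G] by (auto simp: clopenin_def)

lemma section_subset_U: "chain_section \<F> V \<Longrightarrow> V \<subseteq> U"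
  unfolding chain_section_def using F_subset by auto

lemma section_openin: "chain_section \<F> V \<Longrightarrow> openin X V"
  unfolding chain_section_def using F_openin by (auto intro!: openin_Union)

lemma section_member: "C \<in> \<F> \<Longrightarrow> chain_section \<F> C"
  unfolding chain_section_def by (intro exI[of _ "{C}"]) auto

lemma subset_closure: "chain_section \<F> V \<Longrightarrow> V \<subseteq> X closure_of V"
  using section_subset_U[of V] by (intro closure_of_subset) auto

lemma section_least_above:
  assumes "chain_section \<F> V" "V \<noteq> U"
  obtains M where "M \<in> \<F>" "\<not> M \<subseteq> V" "\<forall>D\<in>\<F>. \<not> D \<subseteq> V \<longrightarrow> M \<subseteq> D"
proof -
  have "\<not> U \<subseteq> V" using assms section_subset_U by auto
  then obtain C where C: "C \<in> \<F>" "\<not> C \<subseteq> V" using F_cover by auto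
  show thesis
    by (rule wchain_least[OF F_chain C(1), where P = "\<lambda>C. \<not> C \<subseteq> V"]) (use C(2) that in auto)
qed

lemma closure_subset_member:
  assumes "chain_section \<F> V" "C \<in> \<F>" "\<not> C \<subseteq> V"
  shows "X closure_of V \<subseteq> C"
  using chain_section_linear[OF F_chain assms(1,2)] assms(3) F_clopen[OF assms(2)]
  by (intro closure_of_minimal) (auto simp: clopenin_def)

lemma closure_subset_U:
  assumes "chain_section \<F> V" "V \<noteq> U"
  shows "X closure_of V \<subseteq> U"
proof -
  obtain M where "M \<in> \<F>" "\<not> M \<subseteq> V" by (rule section_least_above[OF assms])
  then show ?thesis using closure_subset_member[OF assms(1)] F_subset by (meson order_trans)
qed

lemma F_unbounded:
  assumes "C \<in> \<F>"
  obtains D where "D \<in> \<F>" "\<not> D \<subseteq> C" "C \<subseteq> D" "\<forall>E\<in>\<F>. \<not> E \<subseteq> C \<longrightarrow> D \<subseteq> E"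
proof -
  obtain M where M: "M \<in> \<F>" "\<not> M \<subseteq> C" "\<forall>D\<in>\<F>. \<not> D \<subseteq> C \<longrightarrow> M \<subseteq> D"
    by (rule section_least_above[OF section_member[OF assms] clopen_neq_U[OF F_clopen[OF assms]]])
  then show thesis using that[of M] wchain_linear[OF F_chain M(1) assms] by blast
qed

lemma boundary_point_section:
  "chain_section \<F> V \<Longrightarrow> \<not> closedin X V \<Longrightarrow> boundary_point X V \<in> X closure_of V - V"
  using section_subset_U[of V] by (intro boundary_point) auto

text \<open>A mark \<open>a\<close> belongs to the closure of its section \<open>V'\<close> but not
  to \<open>V'\<close>. If \<open>V'\<close> were smaller than \<open>V\<close>, a member between
  them would keep that closure inside \<open>V\<close>; if larger, \<open>V'\<close> would contain
  all of \<open>M\<close>. So \<open>V' = V\<close>, and each layer holds at most its own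
  mark.\<close>

lemma marked_in_layer:
  assumes V: "chain_section \<F> V" and M: "M \<in> \<F>" "\<forall>D\<in>\<F>. \<not> D \<subseteq> V \<longrightarrow> M \<subseteq> D"
    and a: "a \<in> marked_points X p \<F>" "a \<in> M" "a \<notin> V"
  shows "\<not> closedin X V \<and> a = boundary_point X V"
proof -
  have "a \<noteq> p" using a(2) F_subset[OF M(1)] by auto
  then obtain V' where V': "chain_section \<F> V'" "\<not> closedin X V'" "a = boundary_point X V'"
    using a(1) unfolding marked_points_def by auto
  then have aV': "a \<in> X closure_of V'" "a \<notin> V'" using boundary_point_section by auto
  have "V \<subseteq> V'"
  proof (rule ccontr)
    assume "\<not> V \<subseteq> V'"
    then obtain C where "C \<in> \<F>" "\<not> C \<subseteq> V'" "C \<subseteq> V"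
      by (rule chain_section_between[OF F_chain V'(1) V])
    then show False using closure_subset_member[OF V'(1)] aV'(1) a(3) by auto
  qed
  moreover have "V' \<subseteq> V"
  proof (rule ccontr)
    assume "\<not> V' \<subseteq> V"
    then obtain C where "C \<in> \<F>" "\<not> C \<subseteq> V" "C \<subseteq> V'"
      by (rule chain_section_between[OF F_chain V V'(1)])
    then have "M \<subseteq> V'" using M(2) by (meson order_trans)
    then show False using a(2) aV'(2) by auto
  qed
  ultimately have "V = V'" by (rule subset_antisym)
  then show ?thesis using V' by simp
qed

text \<open>An unmarked point missed by all of \<open>\<G>\<close> could not be told from the marked
  point \<open>p\<close>, which would then have to lie in every member.\<close>

lemma unmarked_covered:
  assumes "x \<in> topspace X" "x \<notin> marked_points X p \<F>"
  shows "x \<in> \<Union>\<G>"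
proof (rule ccontr)
  assume "x \<notin> \<Union>\<G>"
  then have "\<forall>G\<in>\<G>. p \<in> G"
    using assms G_avoids by (intro G_separates[of p x]) (auto simp: marked_points_def)
  then show False using G_nonempty G_avoids by auto
qed

lemma G_bounded:
  assumes "G \<in> \<G>"
  shows "\<exists>C\<in>\<F>. G \<subseteq> C"
proof -
  have "G \<subseteq> \<Union>\<F>" using G_subset[OF assms] F_cover by simp
  then show ?thesis
    using wchain_compact_cover[OF F_chain F_nonempty F_openin
          clopen_compact[OF G_clopen[OF assms]]] by metis
qed

text \<open>Regularity of the first chain keeps the members of the second chain reached below a given
  stage from being unbounded.\<close>
lemma G_cofinal:
  assumes "C \<in> \<F>"
  shows "\<exists>G\<in>\<G>. C \<subseteq> G"
  using F_chain assms
proof (induction C rule: wchain_induct)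
  case (step C)
  obtain g where g: "\<And>D. D \<in> \<F> \<Longrightarrow> D \<subset> C \<Longrightarrow> g D \<in> \<G> \<and> D \<subseteq> g D"
    using step.IH by metis
  obtain b where b: "\<And>G. G \<in> \<G> \<Longrightarrow> b G \<in> \<F> \<and> G \<subseteq> b G"
    using G_bounded by metis
  \<comment> \<open>The sets \<open>g D\<close> of the induction hypothesis, one for each
    \<open>D\<close> before \<open>C\<close>, are bounded together by regularity.\<close>
  have "\<exists>M\<in>\<F>. \<forall>D\<in>\<F>. D \<subset> C \<longrightarrow> b (g D) \<subseteq> M"
    by (rule F_regular[OF step.hyps]) (use g b in simp)
  then obtain M where M: "M \<in> \<F>" "\<forall>D\<in>\<F>. D \<subset> C \<longrightarrow> b (g D) \<subseteq> M" by auto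
  \<comment> \<open>\<open>M\<close> is closed, so the layer just above it carries no mark. A point
    \<open>z\<close> of this layer lies in some \<open>G\<close>; since \<open>z\<close> is outside
    every \<open>g D\<close>, linearity puts every \<open>g D\<close> inside
    \<open>G\<close>.\<close>
  obtain M' where M': "M' \<in> \<F>" "\<not> M' \<subseteq> M" "M \<subseteq> M'" "\<forall>E\<in>\<F>. \<not> E \<subseteq> M \<longrightarrow> M' \<subseteq> E"
    by (rule F_unbounded[OF M(1)])
  then obtain z where z: "z \<in> M'" "z \<notin> M" by auto
  have "z \<notin> marked_points X p \<F>"
    using marked_in_layer[OF section_member[OF M(1)] M'(1,4) _ z] F_clopen[OF M(1)]
    by (auto simp: clopenin_def)
  moreover have "z \<in> topspace X" using z F_subset[OF M'(1)] by auto
  ultimately obtain G where G: "G \<in> \<G>" "z \<in> G" using unmarked_covered by auto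
  define V where "V = \<Union>{D \<in> \<F>. D \<subset> C}"
  have VG: "V \<subseteq> G"
    unfolding V_def
  proof (intro Union_least)
    fix D assume "D \<in> {D \<in> \<F>. D \<subset> C}"
    then have D: "D \<in> \<F>" "D \<subset> C" by auto
    have "g D \<subseteq> M" using b[of "g D"] g[OF D] M(2) D by auto
    then have "\<not> G \<subseteq> g D" using G(2) z(2) by auto
    then have "g D \<subseteq> G" using wchain_linear[OF G_chain G(1), of "g D"] g[OF D] by auto
    then show "D \<subseteq> G" using g[OF D] by auto
  qed
  have V: "chain_section \<F> V"
    unfolding V_def chain_section_def by (intro exI[of _ "{D \<in> \<F>. D \<subset> C}"]) auto
  have clG: "X closure_of V \<subseteq> G"
    using VG G_clopen[OF G(1)] by (intro closure_of_minimal) (auto simp: clopenin_def)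
  have least: "\<forall>D\<in>\<F>. \<not> D \<subseteq> V \<longrightarrow> C \<subseteq> D"
    using wchain_linear[OF F_chain _ step.hyps] unfolding V_def by blast
  \<comment> \<open>The only point of \<open>C - V\<close> that could be marked is the boundary
    point of \<open>V\<close>, and it lies in the closed set \<open>G\<close>.\<close>
  have "x \<in> \<Union>\<G>" if x: "x \<in> C" for x
  proof (cases "x \<in> V \<or> x \<notin> marked_points X p \<F>")
    case True
    then show ?thesis
      using unmarked_covered[of x] VG G(1) x F_subset[OF step.hyps] by blast
  next
    case False
    then have "\<not> closedin X V \<and> x = boundary_point X V"
      using marked_in_layer[OF V step.hyps least] x by auto
    then have "x \<in> X closure_of V" using boundary_point_section[OF V] by simp
    then show ?thesis using clG G(1) by auto
  qed
  then have "C \<subseteq> \<Union>\<G>" by auto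
  then show ?case
    using wchain_compact_cover[OF G_chain G_nonempty G_openin
          clopen_compact[OF F_clopen[OF step.hyps]]] by metis
qed

text \<open>Let \<open>M\<close> and \<open>G\<close> be the next members of the two chains beyond a
  non-closed \<open>V\<close>. Any point of \<open>M \<inter> G\<close> outside \<open>V\<close>
  other than the mark would be unmarked yet inseparable from the mark by \<open>\<G>\<close>. So
  \<open>M \<inter> G\<close> adds only the mark to \<open>V\<close> and equals the closure.\<close>

lemma common_section_closure:
  assumes VF: "chain_section \<F> V" and VG: "chain_section \<G> V" and "V \<noteq> U"
  shows "clopenin X (X closure_of V)" "X closure_of V - V \<subseteq> {boundary_point X V}"
proof -
  have "clopenin X (X closure_of V) \<and> X closure_of V - V \<subseteq> {boundary_point X V}"
  proof (cases "closedin X V")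
    case True
    then show ?thesis
      using section_openin[OF VF] by (simp add: closure_of_closedin clopenin_def)
  next
    case False
    define y where "y = boundary_point X V"
    have y: "y \<in> X closure_of V" "y \<notin> V" using boundary_point_section[OF VF False] by (auto simp: y_def)
    have y_marked: "y \<in> marked_points X p \<F>"
      unfolding y_def marked_points_def using VF \<open>V \<noteq> U\<close> False by auto
    obtain M where M: "M \<in> \<F>" "\<not> M \<subseteq> V" "\<forall>D\<in>\<F>. \<not> D \<subseteq> V \<longrightarrow> M \<subseteq> D"
      by (rule section_least_above[OF VF \<open>V \<noteq> U\<close>])
    obtain H where H: "H \<in> \<G>" "\<not> H \<subseteq> V" using G_cofinal[OF M(1)] M(2) by (meson order_trans)
    have "\<exists>G\<in>\<G>. \<not> G \<subseteq> V \<and> (\<forall>D\<in>\<G>. \<not> D \<subseteq> V \<longrightarrow> G \<subseteq> D)"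
      by (rule wchain_least[OF G_chain H(1), where P = "\<lambda>C. \<not> C \<subseteq> V"]) (use H(2) in blast)+
    then obtain G where G: "G \<in> \<G>" "\<not> G \<subseteq> V" "\<forall>D\<in>\<G>. \<not> D \<subseteq> V \<longrightarrow> G \<subseteq> D" by auto
    have clM: "X closure_of V \<subseteq> M" by (rule closure_subset_member[OF VF M(1,2)])
    have "V \<subseteq> G" using chain_section_linear[OF G_chain VG G(1)] G(2) by auto
    then have clG: "X closure_of V \<subseteq> G"
      using G_clopen[OF G(1)] by (intro closure_of_minimal) (auto simp: clopenin_def)
    \<comment> \<open>This yields a member \<open>K\<close> of \<open>\<G>\<close> inside
      \<open>V\<close>. It misses the mark \<open>y\<close>, which rules out the exemption in
      \<open>G_separates\<close>.\<close>
    have "V \<noteq> {}" using False by auto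
    then obtain K where K: "K \<in> \<G>" "K \<subseteq> V" using VG unfolding chain_section_def by auto
    have only: "x = y" if x: "x \<in> M" "x \<in> G" "x \<notin> V" for x
    proof (rule ccontr)
      assume "x \<noteq> y"
      then have x_marked: "x \<notin> marked_points X p \<F>"
        using marked_in_layer[OF VF M(1,3) _ x(1,3)] unfolding y_def by auto
      \<comment> \<open>A member of \<open>\<G>\<close> inside \<open>V\<close> contains neither
        point; any other contains \<open>G\<close> and thus both.\<close>
      have "y \<in> D \<longleftrightarrow> x \<in> D" if "D \<in> \<G>" for D
        using bspec[OF G(3) that] clG x y by (cases "D \<subseteq> V") auto
      moreover have "x \<in> topspace X" using x(1) F_subset[OF M(1)] by auto
      ultimately have "\<forall>D\<in>\<G>. y \<in> D" using G_separates[OF y_marked _ x_marked] by auto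
      then show False using K y(2) by auto
    qed
    have "X closure_of V = M \<inter> G"
      using clM clG only y subset_closure[OF VF] by blast
    moreover have "clopenin X (M \<inter> G)"
      using F_clopen[OF M(1)] G_clopen[OF G(1)] by (simp add: clopenin_def closedin_Int openin_Int)
    ultimately show ?thesis using only unfolding y_def by auto
  qed
  then show "clopenin X (X closure_of V)" "X closure_of V - V \<subseteq> {boundary_point X V}" by auto
qed

text \<open>Alternating between the mutually cofinal chains for \<omega> steps gives a union that is
  a section of both. Regularity above an infinite initial segment keeps this union bounded.\<close>

lemma common_sections_cover:
  assumes C: "C \<in> \<F>" and inf: "infinite {D \<in> \<F>. D \<subset> C}" and x: "x \<in> U"
  obtains V where "chain_section \<F> V" "chain_section \<G> V" "V \<noteq> U" "x \<in> V"
proof -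
  obtain g where g: "\<And>D. D \<in> \<F> \<Longrightarrow> g D \<in> \<G> \<and> D \<subseteq> g D" using G_cofinal by metis
  obtain b where b: "\<And>G. G \<in> \<G> \<Longrightarrow> b G \<in> \<F> \<and> G \<subseteq> b G" using G_bounded by metis
  obtain D where D: "D \<in> \<F>" "x \<in> D" using x F_cover by auto
  define s where "s n = ((\<lambda>E. b (g E)) ^^ n) D" for n
  have sF: "s n \<in> \<F>" for n
    by (induction n) (use D g b in \<open>auto simp: s_def\<close>)
  have s_Suc: "s (Suc n) = b (g (s n))" for n by (simp add: s_def)
  \<comment> \<open>The injection lets the sequence \<open>s\<close> be indexed by members below
    \<open>C\<close>, as regularity requires. Off the range of \<open>e\<close> the value of
    \<open>inv e\<close> is arbitrary, which is harmless because every \<open>s n\<close> is in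
    \<open>\<F>\<close>.\<close>
  obtain e :: "nat \<Rightarrow> 'a set" where e: "inj e" "range e \<subseteq> {D \<in> \<F>. D \<subset> C}"
    using infinite_countable_subset[OF inf] by auto
  obtain M where M: "M \<in> \<F>" "\<forall>E\<in>\<F>. E \<subset> C \<longrightarrow> s (inv e E) \<subseteq> M"
    using F_regular[OF C, of "\<lambda>E. s (inv e E)"] sF by auto
  have sM: "s n \<subseteq> M" for n
  proof -
    have "e n \<in> \<F>" "e n \<subset> C" using e(2) by auto
    then have "s (inv e (e n)) \<subseteq> M" by (rule mp[OF bspec[OF M(2)]])
    then show ?thesis unfolding inv_f_f[OF e(1)] .
  qed
  have gs: "g (s n) \<in> \<G> \<and> s n \<subseteq> g (s n)" for n by (rule g[OF sF])
  have step: "g (s n) \<subseteq> s (Suc n)" for n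
    unfolding s_Suc using conjunct2[OF b[OF conjunct1[OF gs]]] .
  have eq: "(\<Union>n. s n) = (\<Union>n. g (s n))"
    using gs step by (intro subset_antisym UN_least) (blast intro: UN_I)+
  show thesis
  proof (rule that[of "\<Union>n. s n"])
    show "chain_section \<F> (\<Union>n. s n)"
      unfolding chain_section_def using sF by (intro exI[of _ "range s"]) auto
    show "chain_section \<G> (\<Union>n. s n)"
      unfolding chain_section_def eq using gs by (intro exI[of _ "range (\<lambda>n. g (s n))"]) auto
    have "(\<Union>n. s n) \<subseteq> M" using sM by auto
    then show "(\<Union>n. s n) \<noteq> U" using F_subset[OF M(1)] clopen_neq_U[OF F_clopen[OF M(1)]] by blast
    have "s 0 = D" by (simp add: s_def)
    then show "x \<in> (\<Union>n. s n)" using D(2) by auto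
  qed
qed

lemma ordlike_topspace:
  assumes good: "\<And>Z. clopenin X Z \<Longrightarrow> p \<notin> Z \<Longrightarrow> ordlike X Z"
  shows "ordlike X (topspace X)"
proof (cases "\<exists>C\<in>\<F>. infinite {D \<in> \<F>. D \<subset> C}")
  case False
  show ?thesis
  proof (rule ordlike_exhaustion[OF F_chain F_clopen p F_cover good])
    fix W assume "W \<in> \<F>"
    \<comment> \<open>All proper initial segments are finite here, so each earlier stage is a finite
      union of clopen sets.\<close>
    then have "closedin X (\<Union>{W' \<in> \<F>. W' \<subset> W})"
      using False F_clopen by (intro closedin_Union) (auto simp: clopenin_def)
    then show "closedin X (\<Union>{W' \<in> \<F>. W' \<subset> W}) \<or> (\<exists>y. W - \<Union>{W' \<in> \<F>. W' \<subset> W} \<subseteq> {y})" ..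
  qed
next
  case True
  then obtain C where C: "C \<in> \<F>" "infinite {D \<in> \<F>. D \<subset> C}" by auto
  \<comment> \<open>The closures of these bounded common sections will form the filtration.\<close>
  define \<V> where "\<V> = {V. chain_section \<F> V \<and> chain_section \<G> V \<and> V \<noteq> U}"
  let ?cl = "\<lambda>V. X closure_of V"
  have clopen: "clopenin X (?cl V)" and bd: "?cl V - V \<subseteq> {boundary_point X V}"
    and cl_U: "?cl V \<subseteq> U" and cl_sup: "V \<subseteq> ?cl V" if "V \<in> \<V>" for V
    using that common_section_closure[of V] closure_subset_U[of V] subset_closure[of V]
    unfolding \<V>_def by auto
  show ?thesis
  proof (rule ordlike_exhaustion[OF _ _ p _ good])
    have "wchain \<V>"
      by (rule wchain_subset[OF wchain_sections[OF F_chain]]) (auto simp: \<V>_def)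
    then show "wchain (?cl ` \<V>)" by (rule wchain_image) (rule closure_of_mono)
    show "clopenin X W" if "W \<in> ?cl ` \<V>" for W using that clopen by auto
    show "\<Union>(?cl ` \<V>) = U"
    proof
      show "\<Union>(?cl ` \<V>) \<subseteq> U" using cl_U by auto
      show "U \<subseteq> \<Union>(?cl ` \<V>)"
      proof
        fix x assume "x \<in> U"
        then obtain V where "chain_section \<F> V" "chain_section \<G> V" "V \<noteq> U" "x \<in> V"
          by (rule common_sections_cover[OF C])
        then have "V \<in> \<V>" "x \<in> V" unfolding \<V>_def by auto
        then show "x \<in> \<Union>(?cl ` \<V>)" using cl_sup by auto
      qed
    qed
  next
    fix W assume "W \<in> ?cl ` \<V>"
    then obtain V where V: "V \<in> \<V>" "W = ?cl V" by auto
    \<comment> \<open>\<open>P\<close> is a common section, whereas the stage \<open>Q\<close>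
      preceding \<open>W\<close> is a union of closures. The inclusions below squeeze
      \<open>Q\<close> between \<open>P\<close> and the closure of \<open>P\<close>.\<close>
    define P where "P = \<Union>{V' \<in> \<V>. ?cl V' \<subset> ?cl V}"
    define Q where "Q = \<Union>{W' \<in> ?cl ` \<V>. W' \<subset> W}"
    have P_sub: "P \<subseteq> ?cl V" unfolding P_def using cl_sup by blast
    have P: "P \<in> \<V>"
    proof -
      have "chain_section \<F> P" "chain_section \<G> P"
        unfolding P_def by (rule chain_section_Union; simp add: \<V>_def)+
      moreover have "P \<noteq> U" using P_sub cl_U[OF V(1)] clopen_neq_U[OF clopen[OF V(1)]] by blast
      ultimately show ?thesis unfolding \<V>_def by simp
    qed
    have PQ: "P \<subseteq> Q" unfolding P_def Q_def V(2) using cl_sup by blast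
    have "?cl V' \<subseteq> ?cl P" if "V' \<in> \<V>" "?cl V' \<subset> ?cl V" for V'
      using that unfolding P_def by (intro closure_of_mono) auto
    then have Qcl: "Q \<subseteq> ?cl P" unfolding Q_def V(2) by blast
    have clPV: "?cl P \<subseteq> ?cl V" using P_sub by (intro closure_of_minimal) auto
    \<comment> \<open>If the closure of \<open>P\<close> is already \<open>W\<close>, the layer
      contains at most the boundary point of \<open>P\<close>. Otherwise that closure is an earlier
      stage, hence equals \<open>Q\<close>.\<close>
    have "closedin X Q \<or> (\<exists>y. W - Q \<subseteq> {y})"
    proof (cases "?cl P = ?cl V")
      case True
      then show ?thesis using bd[OF P] PQ V(2) by blast
    next
      case False
      then have "?cl P \<subseteq> Q" unfolding Q_def V(2) using clPV P by blast
      then have "Q = ?cl P" using Qcl by auto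
      then show ?thesis by simp
    qed
    then show "closedin X (\<Union>{W' \<in> ?cl ` \<V>. W' \<subset> W}) \<or> (\<exists>y. W - \<Union>{W' \<in> ?cl ` \<V>. W' \<subset> W} \<subseteq> {y})"
      unfolding Q_def .
  qed
qed

end

subsection \<open>Compact scattered spaces\<close>

text \<open>Cleave \<open>{p}\<close>: a second point outside all members would be inseparable from
  \<open>p\<close>.\<close>

lemma chain_cleavable_cover:
  assumes "chain_cleavable X" "p \<in> topspace X"
  shows "\<exists>\<C>. \<C> \<noteq> {} \<and> wchain \<C> \<and> (\<forall>C\<in>\<C>. clopenin X C) \<and> \<Union>\<C> = topspace X - {p}"
proof -
  have p: "{p} \<subseteq> topspace X" using assms(2) by simp
  obtain \<C> where C: "\<C> \<noteq> {}" "wchain \<C>" "\<forall>C\<in>\<C>. clopenin X C \<and> p \<notin> C"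
    and sep: "\<forall>x\<in>{p}. \<forall>y\<in>topspace X - {p}. (\<forall>C\<in>\<C>. x \<in> C \<longleftrightarrow> y \<in> C) \<longrightarrow> (\<forall>C\<in>\<C>. x \<in> C)"
    using chain_cleavableD[OF assms(1) singletonI p] by (elim exE conjE)
  have "C \<subseteq> topspace X - {p}" if "C \<in> \<C>" for C
    using C(3) that closedin_subset[of X C] unfolding clopenin_def by auto
  moreover have "y \<in> \<Union>\<C>" if y: "y \<in> topspace X - {p}" for y
  proof (rule ccontr)
    assume "y \<notin> \<Union>\<C>"
    then have "\<forall>C\<in>\<C>. p \<in> C \<longleftrightarrow> y \<in> C" using C(3) by auto
    then have "\<forall>C\<in>\<C>. p \<in> C" using bspec[OF bspec[OF sep, of p] y] by simp
    then show False using C(1,3) by auto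
  qed
  ultimately have "\<Union>\<C> = topspace X - {p}" by blast
  then show ?thesis using C by blast
qed

text \<open>An isolated \<open>p\<close> is split off as a clopen singleton. Otherwise a first chain
  at \<open>p\<close> is thinned to a regular one, and cleaving its marked points provides the
  second chain.\<close>

lemma ordlike_if_avoiding:
  assumes compact: "compact_space X" and cl: "chain_cleavable X" and p: "p \<in> topspace X"
    and good: "\<And>Z. clopenin X Z \<Longrightarrow> p \<notin> Z \<Longrightarrow> ordlike X Z"
  shows "ordlike X (topspace X)"
proof -
  obtain \<C> where C: "\<C> \<noteq> {}" "wchain \<C>" "\<forall>C\<in>\<C>. clopenin X C" "\<Union>\<C> = topspace X - {p}"
    using chain_cleavable_cover[OF cl p] by auto
  show ?thesis
  proof (cases "openin X {p}")
    case True
    have "openin X (topspace X - {p})"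
      unfolding C(4)[symmetric] using C(3) by (intro openin_Union) (auto simp: clopenin_def)
    then have pc: "clopenin X {p}" using True p by (simp add: clopenin_def closedin_def)
    then have Uc: "clopenin X (topspace X - {p})"
      using \<open>openin X (topspace X - {p})\<close> by (auto simp: clopenin_def)
    have "ordlike X ({p} \<union> (topspace X - {p}))"
      using ordlike_Un[OF ordlike_singleton[OF pc] good[OF Uc] pc Uc] by simp
    then show ?thesis using p by (simp add: insert_absorb)
  next
    case False
    obtain \<F> where F: "\<F> \<subseteq> \<C>" "\<forall>C\<in>\<C>. \<exists>D\<in>\<F>. C \<subseteq> D"
      and regular: "\<forall>D\<in>\<F>. \<forall>h. (\<forall>E\<in>\<F>. E \<subset> D \<longrightarrow> h E \<in> \<C>) \<longrightarrow>
        (\<exists>M\<in>\<F>. \<forall>E\<in>\<F>. E \<subset> D \<longrightarrow> h E \<subseteq> M)"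
      using regular_subchain[OF C(2)] by (elim exE conjE)
    have FU: "\<Union>\<F> = topspace X - {p}"
    proof
      show "\<Union>\<F> \<subseteq> topspace X - {p}" using F(1) unfolding C(4)[symmetric] by (rule Union_mono)
      show "topspace X - {p} \<subseteq> \<Union>\<F>" using F(2) unfolding C(4)[symmetric] by auto
    qed
    have "boundary_point X V \<in> topspace X" if V: "chain_section \<F> V" "\<not> closedin X V" for V
    proof -
      obtain \<W> where "\<W> \<subseteq> \<F>" "V = \<Union>\<W>" using V(1) unfolding chain_section_def by auto
      then have "V \<subseteq> topspace X" using FU by auto
      then show ?thesis using boundary_point[OF _ V(2)] closure_of_subset_topspace[of X V] by auto
    qed
    then have "marked_points X p \<F> \<subseteq> topspace X" using p unfolding marked_points_def by auto
    moreover have "p \<in> marked_points X p \<F>" unfolding marked_points_def by simp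
    ultimately have "\<exists>\<G>. \<G> \<noteq> {} \<and> wchain \<G> \<and> (\<forall>G\<in>\<G>. clopenin X G \<and> p \<notin> G) \<and>
      (\<forall>x\<in>marked_points X p \<F>. \<forall>y\<in>topspace X - marked_points X p \<F>.
         (\<forall>G\<in>\<G>. x \<in> G \<longleftrightarrow> y \<in> G) \<longrightarrow> (\<forall>G\<in>\<G>. x \<in> G))"
      by (intro chain_cleavableD[OF cl])
    then obtain \<G> where G: "\<G> \<noteq> {}" "wchain \<G>" "\<forall>G\<in>\<G>. clopenin X G \<and> p \<notin> G"
      "\<forall>x\<in>marked_points X p \<F>. \<forall>y\<in>topspace X - marked_points X p \<F>.
         (\<forall>G\<in>\<G>. x \<in> G \<longleftrightarrow> y \<in> G) \<longrightarrow> (\<forall>G\<in>\<G>. x \<in> G)"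
      by (elim exE conjE)
    interpret cleaving_chains X p \<F> \<G>
    proof
      show "\<exists>M\<in>\<F>. \<forall>D\<in>\<F>. D \<subset> C \<longrightarrow> h D \<subseteq> M"
        if "C \<in> \<F>" "\<And>D. D \<in> \<F> \<Longrightarrow> D \<subset> C \<Longrightarrow> h D \<in> \<F>" for C h
      proof -
        have "\<forall>E\<in>\<F>. E \<subset> C \<longrightarrow> h E \<in> \<C>" using that(2) F(1) by auto
        then show ?thesis by (rule mp[OF spec[OF bspec[OF regular that(1)]]])
      qed
      show "\<forall>G\<in>\<G>. x \<in> G"
        if "x \<in> marked_points X p \<F>" "y \<in> topspace X" "y \<notin> marked_points X p \<F>"
          "\<And>G. G \<in> \<G> \<Longrightarrow> x \<in> G \<longleftrightarrow> y \<in> G" for x y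
      proof (rule mp[OF bspec[OF bspec[OF G(4) that(1)]]])
        show "y \<in> topspace X - marked_points X p \<F>" using that(2,3) by simp
      qed (intro ballI that(4))
      show "wchain \<F>" by (rule wchain_subset[OF C(2) F(1)])
      show "clopenin X C" if "C \<in> \<F>" for C using that F(1) C(3) by auto
      show "clopenin X H" "p \<notin> H" if "H \<in> \<G>" for H using G(3) that by simp_all
    qed (rule compact p False FU G)+
    show ?thesis by (rule ordlike_topspace[OF good])
  qed
qed

section \<open>Restriction to clopen subspaces and scatteredness\<close>

lemma clopenin_subtopology:
  assumes "clopenin X N"
  shows "clopenin (subtopology X N) Z \<longleftrightarrow> clopenin X Z \<and> Z \<subseteq> N"
  using assms openin_open_subtopology[of X N Z] closedin_closed_subtopology[of X N Z]
  unfolding clopenin_def by auto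

lemma ordlike_subtopology:
  assumes N: "clopenin X N" and Z: "Z \<subseteq> N"
  shows "ordlike (subtopology X N) Z \<longleftrightarrow> ordlike X Z"
proof -
  have "underS s a \<subseteq> N" "under s a \<subseteq> N" if "Field s = Z" for s :: "'a rel" and a
    using that Z by (auto simp: underS_def under_def Field_def)
  then have "openin (subtopology X N) (underS s a) \<and> closedin (subtopology X N) (under s a) \<longleftrightarrow>
      openin X (underS s a) \<and> closedin X (under s a)" if "Field s = Z" for s :: "'a rel" and a
    using N that openin_open_subtopology[of X N] closedin_closed_subtopology[of X N]
    unfolding clopenin_def by auto
  then show ?thesis unfolding ordlike_def by (metis (no_types, lifting))
qed

lemma cleavable_over_subtopology:
  assumes "cleavable_over X Y" "N \<subseteq> topspace X"
  shows "cleavable_over (subtopology X N) Y"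
  unfolding cleavable_over_def
proof (intro allI impI)
  fix A assume "A \<subseteq> topspace (subtopology X N)"
  then have A: "A \<subseteq> topspace X" "A \<subseteq> N" by auto
  obtain f where f: "continuous_map X Y f" "f ` A \<inter> f ` (topspace X - A) = {}"
    using assms(1) A(1) unfolding cleavable_over_def by metis
  have "f ` A \<inter> f ` (topspace (subtopology X N) - A) = {}" using f(2) by auto
  then show "\<exists>f. continuous_map (subtopology X N) Y f \<and>
      f ` A \<inter> f ` (topspace (subtopology X N) - A) = {}"
    using continuous_map_from_subtopology[OF f(1)] by auto
qed

text \<open>This extracts scatteredness from simplicity. A set contained in its own derived set
  survives in every transfinite derived set, in particular in \<open>{x}\<close>, whose derived set
  is empty.\<close>

lemma cb_simple_not_dense_in_itself:
  assumes "cb_simple X" "K \<subseteq> topspace X" "K \<noteq> {}"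
  shows "\<not> K \<subseteq> X derived_set_of K"
proof
  assume K: "K \<subseteq> X derived_set_of K"
  have sub: "K \<subseteq> S" if "S \<in> cb_derived_sets X" for S
    using that
  proof induction
    case top
    show ?case by (rule assms(2))
  next
    case (succ S)
    then show ?case using K derived_set_of_mono by (metis order_trans)
  next
    case (lim F)
    then show ?case by auto
  qed
  obtain x where x: "{x} \<in> cb_derived_sets X" "X derived_set_of {x} = {}"
    using assms(1) unfolding cb_simple_def by auto
  have "K \<subseteq> {}" using K derived_set_of_mono[OF sub[OF x(1)], of X] x(2) by auto
  then show False using assms(3) by simp
qed

text \<open>Compactness passes from local to global: finite unions of clopen ordinal-like sets are
  ordinal-like, and so are their clopen subsets.\<close>

lemma ordlike_compact_cover:
  assumes "compactin X Z" "clopenin X Z" "Z \<subseteq> \<Union>{U. clopenin X U \<and> ordlike X U}"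
  shows "ordlike X Z"
proof -
  obtain \<U> where U: "finite \<U>" "\<U> \<subseteq> {U. clopenin X U \<and> ordlike X U}" "Z \<subseteq> \<Union>\<U>"
    using compactinD[OF assms(1) _ assms(3)] by (auto simp: clopenin_def)
  then have "ordlike X (\<Union>\<U>)" using ordlike_clopen_cover[of \<U> X] by auto
  then show ?thesis using assms(2) U(3) by (rule ordlike_subset)
qed

theorem theorem4p3:
  fixes X :: "'a topology" and r :: "'b rel"
  assumes "compact_space X"
    and "infinite (topspace X)"
    and "cb_simple X"
    and "Well_order r"
    and "cleavable_over X (ord_topology r)"
  shows "\<exists>s :: 'a rel. Well_order s \<and> X homeomorphic_space ord_topology s"
proof -
  define K where "K = topspace X - \<Union>{U. clopenin X U \<and> ordlike X U}"
  have clopen_compact: "compactin X Z" if "clopenin X Z" for Z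
    using assms(1) that closedin_compact_space unfolding clopenin_def by blast
  have "K = {}"
  proof (rule ccontr)
    assume "K \<noteq> {}"
    moreover have KX: "K \<subseteq> topspace X" unfolding K_def by auto
    ultimately obtain p where p: "p \<in> K" "p \<notin> X derived_set_of K"
      using cb_simple_not_dense_in_itself[OF assms(3)] by auto
    have pX: "p \<in> topspace X" using p KX by auto
    then obtain T where T: "openin X T" "p \<in> T" "\<And>y. y \<in> K \<Longrightarrow> y \<in> T \<Longrightarrow> y = p"
      using p(2) unfolding in_derived_set_of by auto
    obtain \<C> where C: "\<C> \<noteq> {}" "wchain \<C>" "\<forall>C\<in>\<C>. clopenin X C" "\<Union>\<C> = topspace X - {p}"
      using chain_cleavable_cover[OF cleavable_over_imp_chain_cleavable[OF assms(4,5)] pX] by auto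
    \<comment> \<open>A clopen neighbourhood of \<open>p\<close> inside \<open>T\<close> comes from
      the chain at \<open>p\<close>: one member contains the compact complement of \<open>T\<close>,
      and its own complement is \<open>N\<close>.\<close>
    have "closedin X (topspace X - T)" using T(1) by (simp add: openin_closedin_eq)
    then have "compactin X (topspace X - T)" by (rule closedin_compact_space[OF assms(1)])
    moreover have "topspace X - T \<subseteq> \<Union>\<C>" using C(4) T(2) by auto
    moreover have "openin X C" if "C \<in> \<C>" for C using C(3) that by (auto simp: clopenin_def)
    ultimately obtain C where CC: "C \<in> \<C>" "topspace X - T \<subseteq> C"
      using wchain_compact_cover[OF C(2,1)] by metis
    define N where "N = topspace X - C"
    have N: "clopenin X N" using C(3) CC(1) unfolding N_def clopenin_def by auto
    have NT: "N \<subseteq> T" "N \<subseteq> topspace X" using CC(2) unfolding N_def by auto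
    have pN: "p \<in> N" using pX C(4) CC(1) unfolding N_def by auto
    have "ordlike (subtopology X N) (topspace (subtopology X N))"
    proof (rule ordlike_if_avoiding)
      show "compact_space (subtopology X N)"
        by (rule compact_space_subtopology[OF clopen_compact[OF N]])
      show "chain_cleavable (subtopology X N)"
        by (rule cleavable_over_imp_chain_cleavable[OF assms(4)
              cleavable_over_subtopology[OF assms(5) NT(2)]])
      show "p \<in> topspace (subtopology X N)" using pN pX by simp
      fix Z assume "clopenin (subtopology X N) Z" "p \<notin> Z"
      then have Z: "clopenin X Z" "Z \<subseteq> N" "p \<notin> Z" by (auto simp: clopenin_subtopology[OF N])
      \<comment> \<open>Within \<open>N\<close> the only point of \<open>K\<close> is
        \<open>p\<close>, so every point of \<open>Z\<close> has a clopen ordinal-like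
        neighbourhood.\<close>
      have "Z \<subseteq> \<Union>{U. clopenin X U \<and> ordlike X U}"
      proof
        fix z assume z: "z \<in> Z"
        then have "z \<noteq> p" "z \<in> T" "z \<in> topspace X" using Z NT by auto
        then have "z \<notin> K" using T(3) by metis
        then show "z \<in> \<Union>{U. clopenin X U \<and> ordlike X U}"
          using \<open>z \<in> topspace X\<close> unfolding K_def by blast
      qed
      then have "ordlike X Z" by (rule ordlike_compact_cover[OF clopen_compact[OF Z(1)] Z(1)])
      then show "ordlike (subtopology X N) Z" by (simp add: ordlike_subtopology[OF N Z(2)])
    qed
    then have "ordlike X N"
      using ordlike_subtopology[OF N order_refl] NT(2) by (simp add: Int_absorb1)
    then show False using p(1) pN N unfolding K_def by auto
  qed
  then have "topspace X \<subseteq> \<Union>{U. clopenin X U \<and> ordlike X U}" unfolding K_def by blast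
  moreover have X: "clopenin X (topspace X)" by (simp add: clopenin_def)
  ultimately have "ordlike X (topspace X)"
    by (intro ordlike_compact_cover[OF clopen_compact[OF X] X])
  then show ?thesis by (rule ordlike_imp_homeomorphic[OF assms(1)])
qed

end
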